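(* Let $\mu$ be a Radon measure on $\mathbf{R}^N$ with $\operatorname{supp}\mu\subset D$ and let $T>0$. (a) If $u$ is a solution of the initial-boundary problem with initial data $\mu$ in $[0,T)$, then $\lim_{t\to+0}\int_Du(y,t)\phi(y)\,dy=\int_D\phi\,d\mu$ for all $\phi\in C_0(\mathbf{R}^N)$. (b) Conversely, if $u$ is a solution of the boundary problem in $(0,T)$ and $\lim_{t\to+0}\int_Du(y,t)\phi(y)\,dy=\int_D\phi\,d\mu$ for all $\phi\in C_0(\mathbf{R}^N)$, then $u$ is a solution of the initial-boundary problem with initial data $\mu$ in $[0,T)$.
   Context: Let $N\ge1$, $p>1$. Write $x=(x',x_N)$, $\mathbf{R}^N_+=\{x_N>0\}$, $D:=\overline{\mathbf{R}^N_+}$, identifying $\partial\mathbf{R}^N_+$ with $\mathbf{R}^{N-1}$. Let $\Gamma_N(x,t)=(4\pi t)^{-N/2}e^{-|x|^2/(4t)}$ and $G(x,y,t):=\Gamma_N(x-y,t)+\Gamma_N(x-y_*,t)$, $y_*=(y',-y_N)$. Let $u\ge0$ be continuous on $D\times(0,T)$. It is a solution of the boundary problem ($\partial_tu=\Delta u$ in $\mathbf{R}^N_+$, $\partial_\nu u=u^p$ on $\partial\mathbf{R}^N_+$) in $(0,T)$ if for every $0<\tau<T$ and $(x,t)\in D\times(\tau,T)$, $u(x,t)=\int_DG(x,y,t-\tau)u(y,\tau)\,dy+\int_\tau^t\int_{\mathbf{R}^{N-1}}G(x,(y',0),t-s)u(y',0,s)^p\,dy'\,ds.$ It is a solution of the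 initial-boundary problem with initial data $\mu$ in $[0,T)$ if for all $(x,t)\in D\times(0,T)$, $u(x,t)=\int_DG(x,y,t)\,d\mu(y)+\int_0^t\int_{\mathbf{R}^{N-1}}G(x,(y',0),t-s)u(y',0,s)^p\,dy'\,ds.$ *)

theory Defs
  imports "HOL-Analysis.Analysis"
begin

text \<open>Ambient space R^N is real^'n, N = CARD('n) >= 1. A fixed coordinate k plays the
role of the normal coordinate x_N; the closed half space is D = {x. x$k >= 0}.\<close>

definition half_closed :: "'n::finite \<Rightarrow> (real^'n) set" where
  "half_closed k = {x. x $ k \<ge> 0}"

text \<open>Lebesgue measure on the boundary hyperplane {x. x$k = 0}, identified with R^(N-1):
the product Lebesgue measure on the remaining coordinates (a point mass 1 if N = 1),
pushed forward by y' \<mapsto> (y',0).\<close>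
definition bdry_embed :: "'n::finite \<Rightarrow> ('n \<Rightarrow> real) \<Rightarrow> real^'n" where
  "bdry_embed k f = (\<chi> i. if i = k then 0 else f i)"

definition bdry_measure :: "'n::finite \<Rightarrow> (real^'n) measure" where
  "bdry_measure k = distr (PiM (UNIV - {k}) (\<lambda>_. lborel)) borel (bdry_embed k)"

definition heat_kernel :: "nat \<Rightarrow> 'a::real_normed_vector \<Rightarrow> real \<Rightarrow> real" where
  "heat_kernel N x t = (4 * pi * t) powr (- real N / 2) * exp (- (norm x)\<^sup>2 / (4 * t))"

definition reflect :: "'n::finite \<Rightarrow> real^'n \<Rightarrow> real^'n" where
  "reflect k y = (\<chi> i. if i = k then - (y $ i) else y $ i)"

definition neumann_kernel :: "'n::finite \<Rightarrow> real^'n \<Rightarrow> real^'n \<Rightarrow> real \<Rightarrow> real" where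
  "neumann_kernel k x y t =
     heat_kernel CARD('n) (x - y) t + heat_kernel CARD('n) (x - reflect k y) t"

definition admissible :: "'n::finite \<Rightarrow> real \<Rightarrow> (real^'n \<Rightarrow> real \<Rightarrow> real) \<Rightarrow> bool" where
  "admissible k T u \<longleftrightarrow>
     continuous_on (half_closed k \<times> {0<..<T}) (\<lambda>(x, t). u x t) \<and>
     (\<forall>x\<in>half_closed k. \<forall>t\<in>{0<..<T}. u x t \<ge> 0)"

definition duhamel_bdry ::
  "'n::finite \<Rightarrow> real \<Rightarrow> (real^'n \<Rightarrow> real \<Rightarrow> real) \<Rightarrow> real^'n \<Rightarrow> real \<Rightarrow> real \<Rightarrow> ennreal" where
  "duhamel_bdry k p u x a t =
     (\<integral>\<^sup>+ s\<in>{a..t}. (\<integral>\<^sup>+ z. ennreal (neumann_kernel k x z (t - s) * (u z s) powr p)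
        \<partial>bdry_measure k) \<partial>lborel)"

definition boundary_problem_solution ::
  "'n::finite \<Rightarrow> real \<Rightarrow> real \<Rightarrow> (real^'n \<Rightarrow> real \<Rightarrow> real) \<Rightarrow> bool" where
  "boundary_problem_solution k p T u \<longleftrightarrow> admissible k T u \<and>
     (\<forall>\<tau> x t. 0 < \<tau> \<and> \<tau> < T \<and> x \<in> half_closed k \<and> \<tau> < t \<and> t < T \<longrightarrow>
        ennreal (u x t) =
          (\<integral>\<^sup>+ y\<in>half_closed k. ennreal (neumann_kernel k x y (t - \<tau>) * u y \<tau>) \<partial>lborel)
          + duhamel_bdry k p u x \<tau> t)"

definition initial_boundary_problem_solution ::
  "'n::finite \<Rightarrow> real \<Rightarrow> real \<Rightarrow> (real^'n) measure \<Rightarrow> (real^'n \<Rightarrow> real \<Rightarrow> real) \<Rightarrow> bool" where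
  "initial_boundary_problem_solution k p T \<mu> u \<longleftrightarrow> admissible k T u \<and>
     (\<forall>x t. x \<in> half_closed k \<and> 0 < t \<and> t < T \<longrightarrow>
        ennreal (u x t) =
          (\<integral>\<^sup>+ y\<in>half_closed k. ennreal (neumann_kernel k x y t) \<partial>\<mu>)
          + duhamel_bdry k p u x 0 t)"

definition radon_measure :: "'a::euclidean_space measure \<Rightarrow> bool" where
  "radon_measure \<mu> \<longleftrightarrow> sets \<mu> = sets borel \<and> (\<forall>K. compact K \<longrightarrow> emeasure \<mu> K < \<infinity>)"

definition measure_support :: "'a::metric_space measure \<Rightarrow> 'a set" where
  "measure_support \<mu> = {x. \<forall>e>0. emeasure \<mu> (ball x e) > 0}"

definition C0 :: "('a::euclidean_space \<Rightarrow> real) set" where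
  "C0 = {\<phi>. continuous_on UNIV \<phi> \<and> compact (closure {x. \<phi> x \<noteq> 0})}"

end

theory Submission
  imports Defs "HOL-Probability.Distributions"
begin

text \<open>Part (a): by Tonelli, pairing the solution with \<open>\<phi>\<close> moves the kernel onto \<open>\<phi>\<close>. For a compactly
  supported \<open>\<phi>\<close> and small \<open>r\<close>, the average of \<open>\<phi>\<close> against \<open>G(\<cdot>, y, r)\<close> is at most a constant times
  \<open>G(0, y, q)\<close> for all \<open>q\<close> near a fixed time \<open>t\<^sub>0\<close>. Since \<open>u(0, t\<^sub>0)\<close> is finite, this dominates both the
  integral over \<open>\<mu>\<close>, whose integrand tends to \<open>\<phi>\<close>, and the boundary term, whose time interval shrinks
  to a point.

  Part (b): let \<open>\<tau>\<close> tend to 0 in the formula started at \<open>\<tau>\<close>. The Duhamel term converges monotonically.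
  In the other term, \<open>G(x, y, t - \<tau>)\<close> is comparable, with factors tending to 1, to \<open>G(x, y, t)\<close> for
  bounded \<open>y\<close>, where the trace hypothesis applies; for \<open>y\<close> far from \<open>x\<close> it is a small multiple of
  \<open>G(x, y, t' - \<tau>)\<close> with \<open>t' > t\<close>, whose integral against \<open>u(\<cdot>, \<tau>)\<close> is at most \<open>u(x, t')\<close>.\<close>

section \<open>The Neumann heat kernel\<close>

lemma half_closed_sets [measurable]: "half_closed k \<in> sets borel"
  unfolding half_closed_def by measurable

lemma closed_half_closed: "closed (half_closed k)"
  unfolding half_closed_def by (intro closed_Collect_le continuous_intros)

lemma reflect_nth: "reflect k y $ i = (if i = k then - (y $ i) else y $ i)"
  by (simp add: reflect_def)

lemma reflect_reflect [simp]: "reflect k (reflect k y) = y"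
  by (simp add: reflect_def vec_eq_iff)

lemma reflect_diff: "reflect k (x - y) = reflect k x - reflect k y"
  by (simp add: reflect_def vec_eq_iff)

lemma norm_reflect [simp]: "norm (reflect k y) = norm y"
  by (rule antisym; rule norm_le_componentwise_cart) (simp_all add: reflect_nth)

lemma continuous_on_reflect [continuous_intros]:
  "continuous_on S f \<Longrightarrow> continuous_on S (\<lambda>x. reflect k (f x))"
  unfolding reflect_def
  by (rule continuous_on_vec_lambda, case_tac "i = k") (auto intro!: continuous_intros)

lemma borel_measurable_reflect [measurable]: "reflect k \<in> borel_measurable borel"
  by (intro borel_measurable_continuous_onI continuous_intros)

text \<open>The coordinates of the two differences agree except the normal one, where a difference
  of two nonnegative numbers is compared with their sum. Every estimate in terms of the distance
  from \<open>x\<close> to \<open>y\<close> thereby also covers the mirror summand of the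
  kernel.\<close>

lemma norm_diff_le_reflect:
  "x \<in> half_closed k \<Longrightarrow> y \<in> half_closed k \<Longrightarrow> norm (x - y) \<le> norm (x - reflect k y)"
  by (rule norm_le_componentwise_cart) (auto simp: reflect_nth half_closed_def)

text \<open>The reflection is diagonal with entries 1 and -1, so the Jacobian factor in the affine
  change of variables is 1.\<close>

lemma distr_lborel_reflect: "distr lborel borel (reflect k) = (lborel :: (real^'n::finite) measure)"
proof -
  define c :: "real^'n \<Rightarrow> real" where "c b = (if b = axis k 1 then -1 else 1)" for b
  have "reflect k = (\<lambda>x. 0 + (\<Sum>j\<in>Basis. (c j * (x \<bullet> j)) *\<^sub>R j))"
  proof
    fix x :: "real^'n"
    have "(\<Sum>j\<in>Basis. (c j * (x \<bullet> j)) *\<^sub>R j) = (\<Sum>i\<in>UNIV. (c (axis i 1) * (x \<bullet> axis i 1)) *\<^sub>R axis i 1)"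
      by (simp add: Basis_vec_def, subst sum.reindex_cong[where l = "\<lambda>i. axis i 1" and B = UNIV])
         (auto simp: inj_on_def axis_eq_axis)
    also have "\<dots> = reflect k x"
      by (simp add: vec_eq_iff reflect_nth inner_axis c_def axis_eq_axis)
         (simp add: axis_def if_distrib cong: if_cong, blast)
    finally show "reflect k x = 0 + (\<Sum>j\<in>Basis. (c j * (x \<bullet> j)) *\<^sub>R j)" by simp
  qed
  with lborel_affine_euclidean[of c 0] have "lborel = density (distr lborel borel (reflect k)) (\<lambda>_. \<Prod>j\<in>Basis. \<bar>c j\<bar>)"
    by (simp add: c_def)
  moreover have "(\<Prod>j\<in>Basis. \<bar>c j\<bar>) = 1" by (simp add: c_def if_distrib cong: if_cong)
  ultimately show ?thesis by (simp add: density_1)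
qed

lemma nn_integral_reflect:
  assumes [measurable]: "f \<in> borel_measurable borel"
  shows "(\<integral>\<^sup>+ x. f (reflect k x) \<partial>lborel) = (\<integral>\<^sup>+ x. f x \<partial>(lborel :: (real^'n::finite) measure))"
  by (subst (2) distr_lborel_reflect[symmetric, of k]) (simp add: nn_integral_distr)

lemma AE_lborel_hyperplane: "AE x in (lborel :: (real^'n::finite) measure). x $ k \<noteq> 0"
proof -
  have "{x :: real^'n. x $ k = 0} = {x. x \<bullet> axis k 1 = 0}" by (simp add: inner_axis)
  with negligible_standard_hyperplane[of "axis k 1 :: real^'n" 0]
  have "negligible {x :: real^'n. x $ k = 0}" by (simp add: axis_in_Basis_iff)
  hence "{x :: real^'n. x $ k = 0} \<in> null_sets lebesgue" by (simp add: negligible_iff_null_sets)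
  hence "emeasure lborel {x :: real^'n. x $ k = 0} = 0"
    by (simp add: null_sets_def)
  thus ?thesis by (intro AE_I[where N = "{x. x $ k = 0}"]) auto
qed

section \<open>Measurability and total mass of the kernels\<close>

lemma heat_kernel_nonneg [simp]: "0 \<le> heat_kernel N x t"
  by (simp add: heat_kernel_def)

lemma neumann_kernel_nonneg [simp]: "0 \<le> neumann_kernel k x y t"
  by (simp add: neumann_kernel_def)

lemma borel_measurable_heat_kernel [measurable]:
  fixes f :: "'b \<Rightarrow> 'a::euclidean_space"
  assumes [measurable]: "f \<in> borel_measurable M" "h \<in> borel_measurable M"
  shows "(\<lambda>w. heat_kernel N (f w) (h w)) \<in> borel_measurable M"
  unfolding heat_kernel_def by measurable

lemma borel_measurable_neumann_kernel [measurable]: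
  assumes [measurable]: "f \<in> borel_measurable M" "g \<in> borel_measurable M" "h \<in> borel_measurable M"
  shows "(\<lambda>w. neumann_kernel k (f w) (g w) (h w)) \<in> borel_measurable M"
  unfolding neumann_kernel_def by measurable

text \<open>The kernel at time \<open>r\<close> is the law of independent centred Gaussian
  coordinates of variance \<open>2 * r\<close>; its mass then follows from the product formula for
  \<open>lborel\<close>.\<close>

lemma heat_kernel_eq_prod_normal_density:
  fixes x :: "real^'n::finite"
  assumes "r > 0"
  shows "heat_kernel CARD('n) x r = (\<Prod>b\<in>Basis. normal_density 0 (sqrt (2 * r)) (x \<bullet> b))"
proof -
  have "(\<Prod>b\<in>Basis. normal_density 0 (sqrt (2 * r)) (x \<bullet> b))
      = (\<Prod>b\<in>(Basis :: (real^'n) set). 1 / sqrt (4 * pi * r)) * exp (\<Sum>b\<in>Basis. - (x \<bullet> b)\<^sup>2 / (4 * r))"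
    using assms by (simp add: normal_density_def prod.distrib exp_sum prod_dividef power_one_over mult_ac)
  also have "(\<Prod>b\<in>(Basis :: (real^'n) set). 1 / sqrt (4 * pi * r)) = (4 * pi * r) powr (- real CARD('n) / 2)"
    using assms by (simp add: powr_minus powr_half_sqrt[symmetric] powr_powr powr_realpow[symmetric]
                              power_one_over field_simps powr_power)
  also have "(\<Sum>b\<in>Basis. - (x \<bullet> b)\<^sup>2 / (4 * r)) = - (norm x)\<^sup>2 / (4 * r)"
    using euclidean_inner[of x x] by (simp add: sum_divide_distrib[symmetric] sum_negf power2_norm_eq_inner flip: power2_eq_square)
  finally show ?thesis by (simp add: heat_kernel_def)
qed

lemma nn_integral_heat_kernel:
  fixes y :: "real^'n::finite"
  assumes "r > 0"
  shows "(\<integral>\<^sup>+ x. heat_kernel CARD('n) (x - y) r \<partial>lborel) = 1"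
proof -
  have "(\<integral>\<^sup>+ x. heat_kernel CARD('n) (x - y) r \<partial>lborel)
      = (\<integral>\<^sup>+ x. heat_kernel CARD('n) (x - y) r \<partial>distr lborel borel ((+) y))"
    by (simp add: lborel_distr_plus)
  also have "\<dots> = (\<integral>\<^sup>+ x. heat_kernel CARD('n) x r \<partial>(lborel :: (real^'n) measure))"
    by (subst nn_integral_distr) auto
  also have "\<dots> = (\<integral>\<^sup>+ x. (\<Prod>b\<in>Basis. ennreal (normal_density 0 (sqrt (2 * r)) (x \<bullet> b))) \<partial>(lborel :: (real^'n) measure))"
    using assms by (simp add: heat_kernel_eq_prod_normal_density prod_ennreal)
  also have "\<dots> = 1"
    using assms by (subst nn_integral_lborel_prod) (auto simp: nn_integral_eq_integral)
  finally show ?thesis .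
qed

text \<open>The mirror summand integrated over the half space is the direct summand integrated over
  the opposite half space. Together the two half spaces fill the space and overlap only in a null
  hyperplane, so the mass is that of the whole-space kernel.\<close>

lemma nn_integral_neumann_kernel:
  fixes y :: "real^'n::finite"
  assumes "r > 0"
  shows "(\<integral>\<^sup>+ x\<in>half_closed k. neumann_kernel k x y r \<partial>lborel) = 1"
proof -
  let ?H = "\<lambda>x. ennreal (heat_kernel CARD('n) (x - y) r)"
  have sym: "heat_kernel CARD('n) (x - reflect k y) r = heat_kernel CARD('n) (reflect k x - y) r" for x
    using norm_reflect[of k "x - reflect k y"] by (simp add: heat_kernel_def reflect_diff)
  have "(\<integral>\<^sup>+ x\<in>half_closed k. neumann_kernel k x y r \<partial>lborel)
     = (\<integral>\<^sup>+ x\<in>half_closed k. ?H x \<partial>lborel) + (\<integral>\<^sup>+ x\<in>half_closed k. ?H (reflect k x) \<partial>lborel)"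
    unfolding neumann_kernel_def sym
    by (subst nn_integral_add[symmetric]) (auto intro!: nn_integral_cong simp: indicator_def)
  also have "(\<integral>\<^sup>+ x\<in>half_closed k. ?H (reflect k x) \<partial>lborel)
      = (\<integral>\<^sup>+ x. ?H x * indicator (half_closed k) (reflect k x) \<partial>lborel)"
    by (subst nn_integral_reflect[of _ k, symmetric]) auto
  also have "(\<integral>\<^sup>+ x\<in>half_closed k. ?H x \<partial>lborel) + \<dots> = (\<integral>\<^sup>+ x. ?H x \<partial>lborel)"
    using AE_lborel_hyperplane[of k]
    by (subst nn_integral_add[symmetric])
       (auto intro!: nn_integral_cong_AE simp: indicator_def half_closed_def reflect_nth elim!: eventually_mono)
  finally show ?thesis using assms by (simp add: nn_integral_heat_kernel)
qed

section \<open>Gaussian bounds by kernels at other times\<close>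

text \<open>Half of the exponent at time \<open>r\<close> is the full exponent at time
  \<open>2 * r\<close>. The other half is split off as a decay factor, while what remains still has
  unit mass.\<close>

lemma heat_kernel_le_double_time:
  assumes "r > 0"
  shows "heat_kernel N w r = 2 powr (real N / 2) * exp (- (norm w)\<^sup>2 / (8 * r)) * heat_kernel N w (2 * r)"
proof -
  have "(4 * pi * (2 * r)) powr (- real N / 2) = 2 powr (- real N / 2) * (4 * pi * r) powr (- real N / 2)"
    using assms by (subst powr_mult[symmetric]) (auto simp: mult_ac)
  moreover have "2 powr (real N / 2) * 2 powr (- real N / 2) = (1::real)"
    by (simp add: powr_add[symmetric])
  moreover have "exp (- (norm w)\<^sup>2 / (8 * r)) * exp (- (norm w)\<^sup>2 / (8 * r)) = exp (- (norm w)\<^sup>2 / (4 * r))"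
    using assms by (simp add: exp_add[symmetric] field_simps)
  ultimately show ?thesis unfolding heat_kernel_def
    by (simp add: mult_ac)
qed

text \<open>For \<open>x\<close> in a fixed ball, \<open>norm y\<close> is controlled by
  \<open>R\<close> and \<open>norm (x - y)\<close>, which converts the spare decay in
  \<open>x - y\<close> into decay in \<open>y\<close> alone. The weight depends on \<open>r0\<close>
  but not on \<open>r\<close>, so it holds uniformly for short times.\<close>

lemma heat_kernel_le_weight:
  assumes "0 < r" "r \<le> r0" "norm x \<le> R"
  shows "heat_kernel N (x - y) r
     \<le> 2 powr (real N / 2) * exp (R\<^sup>2 / (8 * r0) - (norm y)\<^sup>2 / (16 * r0)) * heat_kernel N (x - y) (2 * r)"
proof -
  have "norm y \<le> norm x + norm (x - y)"
    using norm_triangle_ineq4[of x "x - y"] by simp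
  hence "(norm y)\<^sup>2 \<le> (norm x + norm (x - y))\<^sup>2" by (simp add: power_mono)
  also have "\<dots> \<le> 2 * (norm x)\<^sup>2 + 2 * (norm (x - y))\<^sup>2"
    using sum_squares_ge_zero[of "norm x - norm (x - y)" 0] by (simp add: power2_eq_square algebra_simps)
  finally have "(norm y)\<^sup>2 \<le> 2 * R\<^sup>2 + 2 * (norm (x - y))\<^sup>2"
    using power_mono[OF assms(3), of 2] by simp
  hence "- (norm (x - y))\<^sup>2 / (8 * r0) \<le> R\<^sup>2 / (8 * r0) - (norm y)\<^sup>2 / (16 * r0)"
    using assms(1,2) by (simp add: field_simps)
  moreover have "(norm (x - y))\<^sup>2 / (8 * r0) \<le> (norm (x - y))\<^sup>2 / (8 * r)"
    using assms(1,2) by (intro divide_left_mono) auto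
  ultimately have "exp (- (norm (x - y))\<^sup>2 / (8 * r)) \<le> exp (R\<^sup>2 / (8 * r0) - (norm y)\<^sup>2 / (16 * r0))"
    by simp
  thus ?thesis unfolding heat_kernel_le_double_time[OF assms(1), of N "x - y"]
    by (intro mult_right_mono mult_left_mono) auto
qed

lemma neumann_kernel_le_weight:
  fixes x y :: "real^'n::finite"
  assumes "0 < r" "r \<le> r0" "norm x \<le> R"
  shows "neumann_kernel k x y r
     \<le> 2 powr (real CARD('n) / 2) * exp (R\<^sup>2 / (8 * r0) - (norm y)\<^sup>2 / (16 * r0)) * neumann_kernel k x y (2 * r)"
  using heat_kernel_le_weight[OF assms, of "CARD('n)" y]
        heat_kernel_le_weight[OF assms, of "CARD('n)" "reflect k y"]
  unfolding neumann_kernel_def distrib_left by (intro add_mono) auto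

lemma neumann_kernel_le_far:
  fixes x y :: "real^'n::finite"
  assumes "0 < r" "0 \<le> \<delta>" "\<delta> \<le> norm (x - y)" "x \<in> half_closed k" "y \<in> half_closed k"
  shows "neumann_kernel k x y r
     \<le> 2 powr (real CARD('n) / 2) * exp (- \<delta>\<^sup>2 / (8 * r)) * neumann_kernel k x y (2 * r)"
proof -
  have far: "heat_kernel CARD('n) w r
      \<le> 2 powr (real CARD('n) / 2) * exp (- \<delta>\<^sup>2 / (8 * r)) * heat_kernel CARD('n) w (2 * r)"
    if "\<delta> \<le> norm w" for w :: "real^'n"
  proof -
    have "exp (- (norm w)\<^sup>2 / (8 * r)) \<le> exp (- \<delta>\<^sup>2 / (8 * r))"
      using assms(1,2) that by (simp add: divide_right_mono power_mono)
    thus ?thesis unfolding heat_kernel_le_double_time[OF assms(1), of "CARD('n)" w]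
      by (intro mult_right_mono mult_left_mono) auto
  qed
  have "\<delta> \<le> norm (x - reflect k y)"
    using norm_diff_le_reflect[OF assms(4,5)] assms(3) by simp
  with far far[OF assms(3)] show ?thesis
    unfolding neumann_kernel_def distrib_left by (intro add_mono) auto
qed

text \<open>Counterpart of the weight bound from above: \<open>4 * r0 \<le> q\<close> makes the
  Gaussian at time \<open>q\<close> at least as wide as the weight, and
  \<open>q \<le> 8 * r0\<close> keeps the normalising factor from below.\<close>

lemma neumann_kernel_0_ge_weight:
  fixes y :: "real^'n::finite"
  assumes "0 < r0" "4 * r0 \<le> q" "q \<le> 8 * r0"
  shows "(32 * pi * r0) powr (- real CARD('n) / 2) * exp (- (norm y)\<^sup>2 / (16 * r0)) \<le> neumann_kernel k 0 y q"
proof -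
  have "(32 * pi * r0) powr (- real CARD('n) / 2) \<le> (4 * pi * q) powr (- real CARD('n) / 2)"
    using assms by (intro powr_mono2') auto
  moreover have "(norm y)\<^sup>2 / (4 * q) \<le> (norm y)\<^sup>2 / (16 * r0)"
    using assms by (intro divide_left_mono) auto
  ultimately have "(32 * pi * r0) powr (- real CARD('n) / 2) * exp (- (norm y)\<^sup>2 / (16 * r0))
      \<le> heat_kernel CARD('n) (0 - y) q"
    unfolding heat_kernel_def by (intro mult_mono) auto
  thus ?thesis unfolding neumann_kernel_def
    using heat_kernel_nonneg[of "CARD('n)" "0 - reflect k y" q] by linarith
qed

section \<open>The kernel averaged against a test function\<close>

text \<open>For nonnegative \<open>\<phi>\<close> this is the Neumann heat semigroup at time
  \<open>r\<close> applied to \<open>\<phi>\<close>, the kernel being symmetric in its two space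
  variables. Integration is in the first of them because that is what Tonelli produces when a
  solution is paired with \<open>\<phi>\<close>.\<close>

definition adjoint_avg :: "'n::finite \<Rightarrow> real \<Rightarrow> (real^'n \<Rightarrow> real) \<Rightarrow> real^'n \<Rightarrow> ennreal" where
  "adjoint_avg k r \<phi> y = (\<integral>\<^sup>+ x\<in>half_closed k. ennreal (neumann_kernel k x y r * \<phi> x) \<partial>lborel)"

text \<open>The gain is that \<open>C\<close> is independent of \<open>r\<close>, \<open>q\<close>
  and \<open>y\<close>. Integrating the weight bound in \<open>x\<close> uses up the unit mass at
  time \<open>2 * r\<close> and leaves a Gaussian weight in \<open>y\<close>, which the kernel from
  the origin dominates. This is the source of all dominating functions for the initial
  trace.\<close>

lemma adjoint_avg_le_kernel:
  fixes \<phi> :: "real^'n::finite \<Rightarrow> real"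
  assumes "\<And>x. 0 \<le> \<phi> x" "\<And>x. \<phi> x \<le> M" "\<And>x. R < norm x \<Longrightarrow> \<phi> x = 0" "0 < r0"
  obtains C where "0 \<le> C"
    "\<And>r q y. 0 < r \<Longrightarrow> r \<le> r0 \<Longrightarrow> 4 * r0 \<le> q \<Longrightarrow> q \<le> 8 * r0 \<Longrightarrow>
       adjoint_avg k r \<phi> y \<le> ennreal (C * neumann_kernel k 0 y q)"
proof -
  \<comment> \<open>\<open>A\<close> is the constant of the lower bound at the origin and
    \<open>B\<close> that of the upper bound without its \<open>y\<close>-dependent factor; the
    witness \<open>M * B / A\<close> is their quotient scaled by the bound on
    \<open>\<phi>\<close>.\<close>
  define A where "A = (32 * pi * r0) powr (- real CARD('n) / 2)"
  define B where "B = 2 powr (real CARD('n) / 2) * exp (R\<^sup>2 / (8 * r0))"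
  have A: "A > 0" using assms(4) by (simp add: A_def)
  have M: "0 \<le> M" using assms(1,2) order_trans by blast
  have B: "B > 0" by (simp add: B_def)
  show thesis
  proof (rule that[of "M * B / A"])
    show "0 \<le> M * B / A" using A B M by simp
    fix r q :: real and y :: "real^'n"
    assume rq: "0 < r" "r \<le> r0" "4 * r0 \<le> q" "q \<le> 8 * r0"
    define E where "E = exp (- (norm y)\<^sup>2 / (16 * r0))"
    have le: "neumann_kernel k x y r * \<phi> x \<le> M * B * E * neumann_kernel k x y (2 * r)" for x
    proof (cases "norm x \<le> R")
      case True
      have "neumann_kernel k x y r * \<phi> x \<le> (B * E * neumann_kernel k x y (2 * r)) * M"
        using neumann_kernel_le_weight[OF rq(1,2) True, of k y] assms(1,2) M
        by (intro mult_mono) (auto simp: B_def E_def exp_diff exp_minus field_simps)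
      thus ?thesis by (simp add: mult_ac)
    qed (use assms(3) M B in \<open>auto simp: E_def\<close>)
    have "adjoint_avg k r \<phi> y
        \<le> (\<integral>\<^sup>+ x. ennreal (M * B * E) * (ennreal (neumann_kernel k x y (2 * r)) * indicator (half_closed k) x) \<partial>lborel)"
      unfolding adjoint_avg_def using le M B
      by (intro nn_integral_mono)
         (auto simp: indicator_def ennreal_mult[symmetric] E_def intro!: ennreal_leI)
    also have "\<dots> = ennreal (M * B * E)"
      using rq(1) by (subst nn_integral_cmult) (auto simp: nn_integral_neumann_kernel)
    also have "\<dots> \<le> ennreal (M * B / A * neumann_kernel k 0 y q)"
    proof (rule ennreal_leI)
      have "A * E \<le> neumann_kernel k 0 y q"
        unfolding A_def E_def using assms(4) rq by (intro neumann_kernel_0_ge_weight)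
      hence "M * B / A * (A * E) \<le> M * B / A * neumann_kernel k 0 y q"
        using M A B by (intro mult_left_mono) auto
      thus "M * B * E \<le> M * B / A * neumann_kernel k 0 y q" using A by simp
    qed
    finally show "adjoint_avg k r \<phi> y \<le> ennreal (M * B / A * neumann_kernel k 0 y q)" .
  qed
qed

lemma adjoint_avg_const:
  assumes "0 < r" "0 \<le> c"
  shows "adjoint_avg k r (\<lambda>_. c) y = ennreal c"
  unfolding adjoint_avg_def using assms nn_integral_neumann_kernel[OF assms(1), of k y]
  by (simp add: ennreal_mult mult_ac nn_integral_cmult[of _ _ "ennreal c"])

text \<open>Within distance \<open>\<delta>\<close> of \<open>y\<close> the functions are compared
  directly, and beyond it the kernel is exponentially small as \<open>r\<close> tends to 0. The
  one-sided form allows \<open>f\<close> and \<open>g\<close> to be a function and a constant in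
  either order, which gives both halves of the convergence at \<open>y\<close>.\<close>

lemma adjoint_avg_le_local:
  fixes f g :: "real^'n::finite \<Rightarrow> real"
  assumes [measurable]: "g \<in> borel_measurable borel"
    and "\<And>x. 0 \<le> f x" "\<And>x. 0 \<le> g x" "0 \<le> \<epsilon>" "0 \<le> M" "0 \<le> \<delta>" "0 < r" "y \<in> half_closed k"
    and near: "\<And>x. norm (x - y) < \<delta> \<Longrightarrow> f x \<le> g x + \<epsilon>" and far: "\<And>x. f x \<le> M"
  shows "adjoint_avg k r f y
     \<le> adjoint_avg k r g y + ennreal (\<epsilon> + M * 2 powr (real CARD('n) / 2) * exp (- \<delta>\<^sup>2 / (8 * r)))"
proof -
  define K where "K = 2 powr (real CARD('n) / 2) * exp (- \<delta>\<^sup>2 / (8 * r))"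
  have K: "0 \<le> K" by (simp add: K_def)
  have le: "neumann_kernel k x y r * f x
      \<le> neumann_kernel k x y r * g x + \<epsilon> * neumann_kernel k x y r + M * K * neumann_kernel k x y (2 * r)"
    if "x \<in> half_closed k" for x
  proof (cases "norm (x - y) < \<delta>")
    case True
    have "neumann_kernel k x y r * f x \<le> neumann_kernel k x y r * (g x + \<epsilon>)"
      by (intro mult_left_mono near True) simp
    moreover have "0 \<le> M * K * neumann_kernel k x y (2 * r)" using assms(5) K by simp
    ultimately show ?thesis by (simp add: algebra_simps)
  next
    case False
    have "neumann_kernel k x y r * f x \<le> (K * neumann_kernel k x y (2 * r)) * M"
      using neumann_kernel_le_far[OF \<open>0 < r\<close> \<open>0 \<le> \<delta>\<close> _ that assms(8)] False far assms(2) K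
      by (intro mult_mono) (auto simp: K_def)
    moreover have "0 \<le> neumann_kernel k x y r * g x + \<epsilon> * neumann_kernel k x y r" using assms(3,4) by simp
    ultimately show ?thesis by (simp add: algebra_simps)
  qed
  have "adjoint_avg k r f y \<le> (\<integral>\<^sup>+ x. ennreal (neumann_kernel k x y r * g x) * indicator (half_closed k) x
      + (ennreal \<epsilon> * (ennreal (neumann_kernel k x y r) * indicator (half_closed k) x)
      + ennreal (M * K) * (ennreal (neumann_kernel k x y (2 * r)) * indicator (half_closed k) x)) \<partial>lborel)"
    unfolding adjoint_avg_def using le assms K
    by (intro nn_integral_mono)
       (auto simp: indicator_def ennreal_mult[symmetric] ennreal_plus[symmetric] add.assoc
             simp del: ennreal_plus intro!: ennreal_leI)
  also have "\<dots> = adjoint_avg k r g y + (ennreal \<epsilon> + ennreal (M * K))"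
    unfolding adjoint_avg_def using assms(7)
    by (simp add: nn_integral_add nn_integral_cmult nn_integral_neumann_kernel)
  also have "\<dots> = adjoint_avg k r g y + ennreal (\<epsilon> + M * K)"
    using assms(4,5) K by simp
  finally show ?thesis by (simp add: K_def mult.assoc)
qed

text \<open>The kernel is an approximate identity on the half space: unit mass, concentrating at
  \<open>y\<close>. The limit is taken for real values and carried back to \<open>ennreal\<close> by
  finiteness of the averages.\<close>

lemma adjoint_avg_tendsto:
  fixes \<phi> :: "real^'n::finite \<Rightarrow> real"
  assumes cont: "continuous_on UNIV \<phi>" and "\<And>x. 0 \<le> \<phi> x" "\<And>x. \<phi> x \<le> M" "y \<in> half_closed k"
  shows "((\<lambda>r. adjoint_avg k r \<phi> y) \<longlongrightarrow> ennreal (\<phi> y)) (at_right 0)"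
proof -
  have [measurable]: "\<phi> \<in> borel_measurable borel"
    using cont by (rule borel_measurable_continuous_onI)
  have M: "0 \<le> M" using assms(2,3) order_trans by blast
  have fin: "adjoint_avg k r \<phi> y = ennreal (enn2real (adjoint_avg k r \<phi> y))" if "0 < r" for r
  proof -
    have "adjoint_avg k r \<phi> y \<le> adjoint_avg k r (\<lambda>_. M) y"
      unfolding adjoint_avg_def
      by (intro nn_integral_mono mult_right_mono ennreal_leI mult_left_mono assms(3)) auto
    also have "\<dots> < top" using that M by (simp add: adjoint_avg_const)
    finally show ?thesis by simp
  qed
  have "((\<lambda>r. enn2real (adjoint_avg k r \<phi> y)) \<longlongrightarrow> \<phi> y) (at_right 0)"
  proof (rule tendstoI)
    fix e :: real assume e: "0 < e"
    have "\<exists>d>0. \<forall>x\<in>UNIV. dist x y < d \<longrightarrow> dist (\<phi> x) (\<phi> y) < e / 2"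
      using cont half_gt_zero[OF e] unfolding continuous_on_iff by (blast intro: UNIV_I)
    then obtain \<delta> where \<delta>: "0 < \<delta>" "\<And>x. norm (x - y) < \<delta> \<Longrightarrow> \<bar>\<phi> x - \<phi> y\<bar> < e / 2"
      unfolding dist_norm real_norm_def by (elim exE conjE) (simp only: UNIV_I ball_UNIV)
    have near: "\<phi> x \<le> \<phi> y + e / 2" "\<phi> y \<le> \<phi> x + e / 2" if "norm (x - y) < \<delta>" for x
      using \<delta>(2)[OF that] by linarith+
    \<comment> \<open>The contribution from outside the \<open>\<delta>\<close>-ball; it vanishes
      with \<open>r\<close> because \<open>\<delta>\<close> is fixed beforehand by continuity at
      \<open>y\<close>.\<close>
    define h where "h r = M * 2 powr (real CARD('n) / 2) * exp (- \<delta>\<^sup>2 / (8 * r))" for r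
    have h: "0 \<le> h r" for r using M by (simp add: h_def)
    have "((\<lambda>r. exp (- \<delta>\<^sup>2 / (8 * r))) \<longlongrightarrow> 0) (at_right 0)"
    proof -
      have "filterlim (\<lambda>r. (\<delta>\<^sup>2 / 8) * inverse r) at_top (at_right 0)"
        using \<delta>(1) by (intro filterlim_tendsto_pos_mult_at_top[OF tendsto_const _ filterlim_inverse_at_top_right]) simp
      hence "((\<lambda>r. exp (- (\<delta>\<^sup>2 / 8 * inverse r))) \<longlongrightarrow> 0) (at_right 0)"
        by (rule filterlim_compose[OF exp_at_bot filterlim_compose[OF filterlim_uminus_at_bot_at_top]])
      moreover have "- \<delta>\<^sup>2 / (8 * r) = - (\<delta>\<^sup>2 / 8 * inverse r)" for r
        by (cases "r = 0") (simp_all add: field_simps)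
      ultimately show ?thesis by (simp only:)
    qed
    hence "(h \<longlongrightarrow> 0) (at_right 0)" unfolding h_def by (rule tendsto_mult_right_zero)
    hence "\<forall>\<^sub>F r in at_right 0. h r < e / 2" using e by (intro order_tendstoD(2)) auto
    moreover have "\<forall>\<^sub>F r :: real in at_right 0. 0 < r" by (simp add: eventually_at_right_less)
    ultimately show "\<forall>\<^sub>F r in at_right 0. dist (enn2real (adjoint_avg k r \<phi> y)) (\<phi> y) < e"
    proof eventually_elim
      case (elim r)
      have "adjoint_avg k r \<phi> y \<le> adjoint_avg k r (\<lambda>_. \<phi> y) y + ennreal (e / 2 + h r)"
        unfolding h_def using assms(2-4) M \<delta>(1) e elim(2) by (intro adjoint_avg_le_local near) simp_all
      also have "\<dots> = ennreal (\<phi> y + (e / 2 + h r))"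
        using elim assms e h[of r] by (simp add: adjoint_avg_const)
      finally have 1: "enn2real (adjoint_avg k r \<phi> y) \<le> \<phi> y + (e / 2 + h r)"
        using assms(2)[of y] e h[of r] by (subst (asm) fin[OF elim(2)]) (simp add: ennreal_le_iff del: ennreal_plus)
      have "ennreal (\<phi> y) = adjoint_avg k r (\<lambda>_. \<phi> y) y"
        using elim assms by (simp add: adjoint_avg_const)
      also have "\<dots> \<le> adjoint_avg k r \<phi> y + ennreal (e / 2 + h r)"
        unfolding h_def using assms(2-4) M \<delta>(1) e elim(2) by (intro adjoint_avg_le_local near) simp_all
      also have "\<dots> = ennreal (enn2real (adjoint_avg k r \<phi> y) + (e / 2 + h r))"
        using e h[of r] by (subst fin[OF elim(2)]) simp
      finally have 2: "\<phi> y \<le> enn2real (adjoint_avg k r \<phi> y) + (e / 2 + h r)"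
        using e h[of r] by (simp add: ennreal_le_iff del: ennreal_plus)
      from 1 2 elim(1) show ?case by (simp add: dist_real_def abs_less_iff)
    qed
  qed
  hence "((\<lambda>r. ennreal (enn2real (adjoint_avg k r \<phi> y))) \<longlongrightarrow> ennreal (\<phi> y)) (at_right 0)" by simp
  moreover have "\<forall>\<^sub>F r in at_right 0. ennreal (enn2real (adjoint_avg k r \<phi> y)) = adjoint_avg k r \<phi> y"
    using eventually_at_right_less by eventually_elim (rule fin[symmetric])
  ultimately show ?thesis by (rule Lim_transform_eventually)
qed

section \<open>The boundary measure and the Duhamel term\<close>

lemma sigma_finite_radon_measure:
  fixes \<mu> :: "'a::euclidean_space measure"
  assumes "radon_measure \<mu>"
  shows "sigma_finite_measure \<mu>"
proof
  have "(\<Union>n. cball (0::'a) (real n)) = UNIV"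
    by (auto simp: real_arch_simple)
  moreover have "sets \<mu> = sets borel" "emeasure \<mu> (cball 0 (real n)) \<noteq> \<infinity>" for n
    using assms unfolding radon_measure_def by (auto simp: less_top[symmetric])
  ultimately show "\<exists>A. countable A \<and> A \<subseteq> sets \<mu> \<and> \<Union>A = space \<mu> \<and> (\<forall>a\<in>A. emeasure \<mu> a \<noteq> \<infinity>)"
    using sets_eq_imp_space_eq[of \<mu> borel]
    by (intro exI[of _ "range (\<lambda>n. cball 0 (real n))"]) auto
qed

text \<open>Pushforwards can destroy sigma-finiteness. A measurable left inverse \<open>g\<close>
  prevents it: the preimages under \<open>g\<close> of a countable cover by sets of finite measure
  cover the target, and pulling them back along \<open>f\<close> returns the original sets.\<close>

lemma sigma_finite_distr_left_inverse:
  assumes "sigma_finite_measure M" and f[measurable]: "f \<in> measurable M N" and g[measurable]: "g \<in> measurable N M"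
    and gf: "\<And>x. x \<in> space M \<Longrightarrow> g (f x) = x"
  shows "sigma_finite_measure (distr M N f)"
proof -
  interpret sigma_finite_measure M by fact
  obtain A where A: "countable A" "A \<subseteq> sets M" "\<Union>A = space M" "\<forall>a\<in>A. emeasure M a \<noteq> \<infinity>"
    using sigma_finite_countable by auto
  define B where "B = (\<lambda>a. g -` a \<inter> space N) ` A"
  have "emeasure (distr M N f) (g -` a \<inter> space N) \<noteq> \<infinity>" if "a \<in> A" for a
  proof -
    have a: "a \<in> sets M" using A that by auto
    have "f -` (g -` a \<inter> space N) \<inter> space M = a"
      using sets.sets_into_space[OF a] gf measurable_space[OF f] by auto
    thus ?thesis using a A that by (simp add: emeasure_distr)
  qed
  moreover have "B \<subseteq> sets N" using A by (auto simp: B_def)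
  moreover have "\<Union>B = space N"
  proof (intro equalityI subsetI)
    fix x assume x: "x \<in> space N"
    from measurable_space[OF g x] obtain a where "a \<in> A" "g x \<in> a" unfolding A(3)[symmetric] by blast
    with x show "x \<in> \<Union>B" by (auto simp: B_def)
  qed (auto simp: B_def)
  ultimately show ?thesis using A(1)
    by unfold_locales (auto simp: B_def intro!: exI[of _ B])
qed

lemma measurable_bdry_embed [measurable]:
  "bdry_embed (k :: 'n::finite) \<in> measurable (PiM (UNIV - {k}) (\<lambda>_. lborel)) borel"
  unfolding borel_measurable_euclidean_space[where f = "bdry_embed k"]
proof
  fix b :: "real^'n" assume "b \<in> Basis"
  then obtain i where b: "b = axis i 1" by (auto simp: Basis_vec_def)
  show "(\<lambda>x. bdry_embed k x \<bullet> b) \<in> borel_measurable (PiM (UNIV - {k}) (\<lambda>_. lborel))"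
    by (cases "i = k") (simp_all add: b inner_axis bdry_embed_def)
qed

lemma sets_bdry_measure [simp, measurable_cong]: "sets (bdry_measure k) = sets borel"
  by (simp add: bdry_measure_def)

lemma sigma_finite_bdry_measure: "sigma_finite_measure (bdry_measure (k :: 'n::finite))"
  unfolding bdry_measure_def
proof (rule sigma_finite_distr_left_inverse)
  interpret product_sigma_finite "\<lambda>_::'n. lborel :: real measure"
    by unfold_locales
  show "sigma_finite_measure (PiM (UNIV - {k}) (\<lambda>_. lborel :: real measure))"
    by (rule sigma_finite) simp
  \<comment> \<open>The left inverse forgets the normal coordinate.\<close>
  show "(\<lambda>x::real^'n. restrict (\<lambda>i. x $ i) (UNIV - {k})) \<in> measurable borel (PiM (UNIV - {k}) (\<lambda>_. lborel))"
    by (rule measurable_restrict) simp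
  show "restrict (\<lambda>i. bdry_embed k x $ i) (UNIV - {k}) = x"
    if "x \<in> space (PiM (UNIV - {k}) (\<lambda>_. lborel :: real measure))" for x
    using that by (auto simp: bdry_embed_def space_PiM fun_eq_iff PiE_def extensional_def)
qed simp

lemma AE_bdry_measure: "AE z in bdry_measure k. z \<in> half_closed k"
  unfolding bdry_measure_def
  by (subst AE_distr_iff) (auto simp: bdry_embed_def half_closed_def)

text \<open>Solutions are unconstrained, hence possibly non-measurable, off \<open>D \<times> (0, T)\<close>;
  Tonelli is applied to the extension by zero.\<close>

definition zero_ext :: "'n::finite \<Rightarrow> real \<Rightarrow> (real^'n \<Rightarrow> real \<Rightarrow> real) \<Rightarrow> real^'n \<Rightarrow> real \<Rightarrow> real" where
  "zero_ext k T u x t = (if x \<in> half_closed k \<and> 0 < t \<and> t < T then u x t else 0)"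

lemma borel_measurable_zero_ext [measurable]:
  assumes "admissible k T u"
  shows "(\<lambda>(x, t). zero_ext k T u x t) \<in> borel_measurable (borel \<Otimes>\<^sub>M borel)"
proof -
  have "half_closed k \<times> {0<..<T} \<in> sets (borel \<Otimes>\<^sub>M borel)" by simp
  hence "(\<lambda>m. indicator (half_closed k \<times> {0<..<T}) m *\<^sub>R (case m of (x, t) \<Rightarrow> u x t)) \<in> borel_measurable borel"
    using assms unfolding borel_prod admissible_def
    by (intro borel_measurable_continuous_on_indicator) auto
  also have "(\<lambda>m. indicator (half_closed k \<times> {0<..<T}) m *\<^sub>R (case m of (x, t) \<Rightarrow> u x t)) = (\<lambda>(x, t). zero_ext k T u x t)"
    by (auto simp: zero_ext_def fun_eq_iff indicator_def)
  finally show ?thesis unfolding borel_prod .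
qed

text \<open>Time comes first to match the product of \<open>lborel\<close> with
  \<open>bdry_measure k\<close>; the zero extension supplies joint measurability.\<close>

definition bdry_flux :: "'n::finite \<Rightarrow> real \<Rightarrow> real \<Rightarrow> (real^'n \<Rightarrow> real \<Rightarrow> real) \<Rightarrow> real \<times> (real^'n) \<Rightarrow> ennreal" where
  "bdry_flux k p T u m = ennreal (zero_ext k T u (snd m) (fst m) powr p)"

lemma borel_measurable_bdry_flux:
  assumes "admissible k T u"
  shows "bdry_flux k p T u \<in> borel_measurable (borel \<Otimes>\<^sub>M borel)"
proof -
  have "(\<lambda>m. (snd m, fst m)) \<in> borel \<Otimes>\<^sub>M borel \<rightarrow>\<^sub>M borel \<Otimes>\<^sub>M (borel :: real measure)" by simp
  from measurable_compose[OF this borel_measurable_zero_ext[OF assms]]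
  show ?thesis unfolding bdry_flux_def[abs_def] by simp
qed

text \<open>Uses the convention \<open>0 powr p = 0\<close>. It makes the endpoint 0 of the time
  interval harmless in pointwise limits.\<close>

lemma bdry_flux_time_0: "fst m \<le> 0 \<Longrightarrow> bdry_flux k p T u m = 0"
  by (simp add: bdry_flux_def zero_ext_def)

text \<open>Written as one integral over space-time, the Duhamel term depends on its starting time
  only through an indicator, so Tonelli and the convergence theorems apply directly.\<close>

lemma duhamel_bdry_eq:
  fixes u :: "real^'n::finite \<Rightarrow> real \<Rightarrow> real"
  assumes adm: "admissible k T u" and "0 \<le> a" "t < T"
  shows "duhamel_bdry k p u x a t = (\<integral>\<^sup>+ m. ennreal (neumann_kernel k x (snd m) (t - fst m))
            * (bdry_flux k p T u m * indicator {a..t} (fst m)) \<partial>(lborel \<Otimes>\<^sub>M bdry_measure k))"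
proof -
  interpret sigma_finite_measure "bdry_measure k" by (rule sigma_finite_bdry_measure)
  note [measurable] = borel_measurable_bdry_flux[OF adm]
  have "(\<integral>\<^sup>+ m. ennreal (neumann_kernel k x (snd m) (t - fst m))
            * (bdry_flux k p T u m * indicator {a..t} (fst m)) \<partial>(lborel \<Otimes>\<^sub>M bdry_measure k))
      = (\<integral>\<^sup>+ s. (\<integral>\<^sup>+ z. ennreal (neumann_kernel k x z (t - s))
            * (bdry_flux k p T u (s, z) * indicator {a..t} s) \<partial>bdry_measure k) \<partial>lborel)"
    by (subst nn_integral_fst[symmetric]) simp_all
  also have "\<dots> = (\<integral>\<^sup>+ s. (\<integral>\<^sup>+ z. ennreal (neumann_kernel k x z (t - s) * (u z s) powr p) \<partial>bdry_measure k)
            * indicator {a..t} s \<partial>lborel)"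
  proof (rule nn_integral_cong_AE)
    show "AE s in lborel. (\<integral>\<^sup>+ z. ennreal (neumann_kernel k x z (t - s))
            * (bdry_flux k p T u (s, z) * indicator {a..t} s) \<partial>bdry_measure k)
          = (\<integral>\<^sup>+ z. ennreal (neumann_kernel k x z (t - s) * (u z s) powr p) \<partial>bdry_measure k) * indicator {a..t} s"
      \<comment> \<open>At time 0 the extension vanishes while \<open>u z 0\<close> is arbitrary;
        this single time is discarded as a null set.\<close>
      using AE_lborel_singleton[of "0::real"]
    proof eventually_elim
      case (elim s)
      show ?case
      proof (cases "s \<in> {a..t}")
        case True
        have "(\<integral>\<^sup>+ z. ennreal (neumann_kernel k x z (t - s)) * bdry_flux k p T u (s, z) \<partial>bdry_measure k)
          = (\<integral>\<^sup>+ z. ennreal (neumann_kernel k x z (t - s) * (u z s) powr p) \<partial>bdry_measure k)"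
          using AE_bdry_measure[of k] True elim assms
          by (intro nn_integral_cong_AE)
             (auto simp: bdry_flux_def zero_ext_def ennreal_mult elim!: eventually_mono)
        with True show ?thesis by simp
      qed simp
    qed
  qed
  finally show ?thesis by (simp add: duhamel_bdry_def)
qed

section \<open>Moving the kernel onto the test function\<close>

lemma borel_measurable_adjoint_avg:
  assumes [measurable]: "\<phi> \<in> borel_measurable borel" "r \<in> borel_measurable M" "h \<in> borel_measurable M"
  shows "(\<lambda>m. adjoint_avg k (r m) \<phi> (h m)) \<in> borel_measurable M"
  unfolding adjoint_avg_def by measurable

text \<open>Tonelli, with elapsed time \<open>r\<close> and source point \<open>h\<close> as
  functions of the integration variable: constant time serves the initial measure, time
  \<open>t - s\<close> the boundary flux.\<close>

lemma nn_integral_adjoint_avg: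
  fixes \<phi> :: "real^'n::finite \<Rightarrow> real"
  assumes "sigma_finite_measure M"
    and [measurable]: "\<phi> \<in> borel_measurable borel" "r \<in> borel_measurable M" "h \<in> borel_measurable M" "w \<in> borel_measurable M"
    and nonneg: "\<And>x. 0 \<le> \<phi> x"
  shows "(\<integral>\<^sup>+ x. ennreal (\<phi> x) * (\<integral>\<^sup>+ m. ennreal (neumann_kernel k x (h m) (r m)) * w m \<partial>M) * indicator (half_closed k) x \<partial>lborel)
      = (\<integral>\<^sup>+ m. adjoint_avg k (r m) \<phi> (h m) * w m \<partial>M)"
proof -
  interpret sigma_finite_measure M by fact
  interpret pair_sigma_finite lborel M ..
  have "(\<integral>\<^sup>+ x. ennreal (\<phi> x) * (\<integral>\<^sup>+ m. ennreal (neumann_kernel k x (h m) (r m)) * w m \<partial>M) * indicator (half_closed k) x \<partial>lborel)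
    = (\<integral>\<^sup>+ x. (\<integral>\<^sup>+ m. (ennreal (\<phi> x) * indicator (half_closed k) x) * (ennreal (neumann_kernel k x (h m) (r m)) * w m) \<partial>M) \<partial>lborel)"
    by (subst nn_integral_cmult) (auto simp: mult_ac)
  also have "\<dots> = (\<integral>\<^sup>+ m. (\<integral>\<^sup>+ x. (ennreal (\<phi> x) * indicator (half_closed k) x) * (ennreal (neumann_kernel k x (h m) (r m)) * w m) \<partial>lborel) \<partial>M)"
    by (rule Fubini'[symmetric]) measurable
  also have "\<dots> = (\<integral>\<^sup>+ m. adjoint_avg k (r m) \<phi> (h m) * w m \<partial>M)"
    unfolding adjoint_avg_def
    by (subst nn_integral_multc[symmetric]) (auto simp: ennreal_mult nonneg mult_ac)
  finally show ?thesis .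
qed

section \<open>Initial traces of solutions\<close>

lemma C0_bounded_support:
  fixes \<phi> :: "'a::euclidean_space \<Rightarrow> real"
  assumes "\<phi> \<in> C0"
  obtains R M where "\<And>x. R < norm x \<Longrightarrow> \<phi> x = 0" "\<And>x. \<bar>\<phi> x\<bar> \<le> M"
proof -
  have cont: "continuous_on UNIV \<phi>" and "bounded (closure {x. \<phi> x \<noteq> 0})"
    using assms by (auto simp: C0_def compact_imp_bounded)
  then obtain R where R: "\<And>x. x \<in> closure {x. \<phi> x \<noteq> 0} \<Longrightarrow> norm x \<le> R"
    unfolding bounded_iff by blast
  have out: "\<phi> x = 0" if "R < norm x" for x
    using R[of x] that closure_subset[of "{x. \<phi> x \<noteq> 0}"] by fastforce
  have "bounded (\<phi> ` cball 0 R)"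
    using cont by (intro compact_imp_bounded compact_continuous_image) (auto intro: continuous_on_subset)
  then obtain M where "\<forall>y\<in>\<phi> ` cball 0 R. norm y \<le> M"
    unfolding bounded_iff by blast
  hence M: "\<bar>\<phi> x\<bar> \<le> M" if "norm x \<le> R" for x using that by simp
  have "\<bar>\<phi> x\<bar> \<le> max M 0" for x
    using M[of x] out[of x] by (cases "norm x \<le> R") auto
  with out show thesis using that by blast
qed

lemma C0I:
  fixes \<phi> :: "'a::euclidean_space \<Rightarrow> real"
  assumes "continuous_on UNIV \<phi>" "\<And>x. R < norm (x - a) \<Longrightarrow> \<phi> x = 0"
  shows "\<phi> \<in> C0"
proof -
  have "{x. \<phi> x \<noteq> 0} \<subseteq> cball a R"
    using assms(2) by (force simp: dist_norm norm_minus_commute)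
  hence "bounded {x. \<phi> x \<noteq> 0}" using bounded_cball bounded_subset by blast
  thus ?thesis using assms(1) by (simp add: C0_def compact_closure)
qed

text \<open>The slice is continuous on the closed half space, and cutting with a ball that contains
  the support leaves a continuous function on a compact set.\<close>

lemma set_integrable_slice_C0:
  assumes adm: "admissible k T u" and t: "0 < t" "t < T" and "\<phi> \<in> C0"
  shows "set_integrable lborel (half_closed k) (\<lambda>y. u y t * \<phi> y)"
proof -
  obtain R where R: "\<And>x. R < norm x \<Longrightarrow> \<phi> x = 0" using C0_bounded_support[OF assms(4)] by metis
  have "continuous_on (half_closed k \<times> {0<..<T}) (\<lambda>(x, t). u x t)"
    using adm by (simp add: admissible_def)
  moreover have "continuous_on (half_closed k) (\<lambda>y. (y, t))"
    by (intro continuous_intros)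
  ultimately have "continuous_on (half_closed k) (\<lambda>y. case (y, t) of (x, t) \<Rightarrow> u x t)"
    by (rule continuous_on_compose2) (use t in auto)
  hence "continuous_on (half_closed k \<inter> cball 0 R) (\<lambda>y. u y t * \<phi> y)"
    using assms(4) unfolding C0_def
    by (intro continuous_on_mult) (auto intro: continuous_on_subset)
  hence "integrable lborel (\<lambda>y. indicator (half_closed k \<inter> cball 0 R) y *\<^sub>R (u y t * \<phi> y))"
    by (intro borel_integrable_compact closed_Int_compact closed_half_closed) auto
  also have "(\<lambda>y. indicator (half_closed k \<inter> cball 0 R) y *\<^sub>R (u y t * \<phi> y)) = (\<lambda>y. indicator (half_closed k) y *\<^sub>R (u y t * \<phi> y))"
    using R by (auto simp: fun_eq_iff indicator_def not_le)
  finally show ?thesis by (simp add: set_integrable_def)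
qed

lemma set_integrable_radon_C0:
  assumes radon: "radon_measure \<mu>" and "\<phi> \<in> C0"
  shows "set_integrable \<mu> (half_closed k) \<phi>"
proof -
  obtain R M where R: "\<And>x. R < norm x \<Longrightarrow> \<phi> x = 0" and M: "\<And>x. \<bar>\<phi> x\<bar> \<le> M"
    using C0_bounded_support[OF assms(2)] by metis
  have [measurable_cong]: "sets \<mu> = sets borel" using radon by (simp add: radon_measure_def)
  have [measurable]: "\<phi> \<in> borel_measurable borel"
    using assms(2) by (auto simp: C0_def intro: borel_measurable_continuous_onI)
  have fin: "emeasure \<mu> (half_closed k \<inter> cball 0 R) < \<infinity>"
    using radon unfolding radon_measure_def
    by (meson closed_Int_compact closed_half_closed compact_cball)
  have "integrable \<mu> (\<lambda>y. indicator (half_closed k) y *\<^sub>R \<phi> y)"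
  proof (rule integrableI_bounded_set[where A = "half_closed k \<inter> cball 0 R" and B = M])
    show "AE x in \<mu>. x \<in> half_closed k \<inter> cball 0 R \<longrightarrow> norm (indicator (half_closed k) x *\<^sub>R \<phi> x) \<le> M"
      using M by auto
    show "AE x in \<mu>. x \<notin> half_closed k \<inter> cball 0 R \<longrightarrow> indicator (half_closed k) x *\<^sub>R \<phi> x = 0"
      using R by (auto simp: not_le)
  qed (use fin in \<open>auto\<close>)
  thus ?thesis by (simp add: set_integrable_def)
qed

text \<open>Bridge between the integral equations, stated in \<open>ennreal\<close>, and the trace
  condition, stated with Bochner integrals.\<close>

lemma set_nn_integral_eq_set_integral:
  fixes f :: "'a \<Rightarrow> real"
  assumes "set_integrable M A f" "\<And>x. x \<in> A \<Longrightarrow> 0 \<le> f x"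
  shows "(\<integral>\<^sup>+ x\<in>A. ennreal (f x) \<partial>M) = ennreal (LINT x:A|M. f x)"
proof -
  have "(\<integral>\<^sup>+ x\<in>A. ennreal (f x) \<partial>M) = (\<integral>\<^sup>+ x. ennreal (indicator A x *\<^sub>R f x) \<partial>M)"
    by (intro nn_integral_cong) (auto simp: indicator_def)
  also have "\<dots> = ennreal (LINT x:A|M. f x)"
    using assms unfolding set_integrable_def set_lebesgue_integral_def
    by (intro nn_integral_eq_integral) (auto simp: indicator_def)
  finally show ?thesis .
qed

text \<open>Nonnegative \<open>\<phi>\<close> keeps the computation in \<open>ennreal\<close>, where
  Tonelli is unconditional. Both resulting terms are treated by dominated convergence, with bounds
  from the finite value of \<open>u\<close> at the origin at time \<open>T / 2\<close>.\<close>

lemma initial_trace_nonneg: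
  fixes u :: "real^'n::finite \<Rightarrow> real \<Rightarrow> real" and \<phi> :: "real^'n \<Rightarrow> real"
  assumes T: "0 < T" and radon: "radon_measure \<mu>"
    and sol: "initial_boundary_problem_solution k p T \<mu> u"
    and cont: "continuous_on UNIV \<phi>" and \<phi>: "\<And>x. 0 \<le> \<phi> x" "\<And>x. \<phi> x \<le> M" "\<And>x. R < norm x \<Longrightarrow> \<phi> x = 0"
  shows "((\<lambda>t. \<integral>\<^sup>+ y\<in>half_closed k. ennreal (u y t * \<phi> y) \<partial>lborel)
      \<longlongrightarrow> (\<integral>\<^sup>+ y\<in>half_closed k. ennreal (\<phi> y) \<partial>\<mu>)) (at_right 0)"
proof -
  have adm: "admissible k T u"
    and eq: "\<And>x t. x \<in> half_closed k \<Longrightarrow> 0 < t \<Longrightarrow> t < T \<Longrightarrow> ennreal (u x t) =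
          (\<integral>\<^sup>+ y\<in>half_closed k. ennreal (neumann_kernel k x y t) \<partial>\<mu>) + duhamel_bdry k p u x 0 t"
    using sol unfolding initial_boundary_problem_solution_def by auto
  have [measurable_cong]: "sets \<mu> = sets borel" using radon by (simp add: radon_measure_def)
  have [measurable]: "\<phi> \<in> borel_measurable borel"
    using cont by (rule borel_measurable_continuous_onI)
  note [measurable] = borel_measurable_bdry_flux[OF adm] borel_measurable_adjoint_avg
  interpret mu: sigma_finite_measure \<mu> by (rule sigma_finite_radon_measure[OF radon])
  interpret bd: sigma_finite_measure "bdry_measure k" by (rule sigma_finite_bdry_measure)
  interpret pair_sigma_finite lborel "bdry_measure k" ..
  let ?F = "bdry_flux k p T u" and ?N = "(lborel :: real measure) \<Otimes>\<^sub>M bdry_measure k"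
  \<comment> \<open>Then \<open>8 * r0\<close> is \<open>T / 2\<close>, a time at which the equation
    holds, and for \<open>0 \<le> s \<le> r0\<close> the time \<open>8 * r0 - s\<close> stays in the
    window required by the kernel bound.\<close>
  define r0 where "r0 = T / 16"
  have r0: "0 < r0" using T by (simp add: r0_def)
  obtain C where C: "0 \<le> C" "\<And>r q y. 0 < r \<Longrightarrow> r \<le> r0 \<Longrightarrow> 4 * r0 \<le> q \<Longrightarrow> q \<le> 8 * r0 \<Longrightarrow>
       adjoint_avg k r \<phi> y \<le> ennreal (C * neumann_kernel k 0 y q)"
    by (rule adjoint_avg_le_kernel[where k = k, OF \<phi> r0 that])
  have u0: "ennreal (u 0 (8 * r0)) = (\<integral>\<^sup>+ y\<in>half_closed k. ennreal (neumann_kernel k 0 y (8 * r0)) \<partial>\<mu>)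
       + (\<integral>\<^sup>+ m. ennreal (neumann_kernel k 0 (snd m) (8 * r0 - fst m)) * (?F m * indicator {0..8 * r0} (fst m)) \<partial>?N)"
    using eq[of 0 "8 * r0"] T duhamel_bdry_eq[OF adm, of 0 "8 * r0" p 0]
    by (simp add: r0_def half_closed_def)
  \<comment> \<open>The sum equals \<open>ennreal\<close> of a real number, so each summand is
    finite.\<close>
  have fin: "(\<integral>\<^sup>+ y\<in>half_closed k. ennreal (neumann_kernel k 0 y (8 * r0)) \<partial>\<mu>) < top"
       "(\<integral>\<^sup>+ m. ennreal (neumann_kernel k 0 (snd m) (8 * r0 - fst m)) * (?F m * indicator {0..8 * r0} (fst m)) \<partial>?N) < top"
    using ennreal_less_top[of "u 0 (8 * r0)"] unfolding u0 ennreal_add_less_top by auto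
  have split: "(\<integral>\<^sup>+ y\<in>half_closed k. ennreal (u y t * \<phi> y) \<partial>lborel)
      = (\<integral>\<^sup>+ y. adjoint_avg k t \<phi> y * indicator (half_closed k) y \<partial>\<mu>)
        + (\<integral>\<^sup>+ m. adjoint_avg k (t - fst m) \<phi> (snd m) * (?F m * indicator {0..t} (fst m)) \<partial>?N)"
    if t: "0 < t" "t < r0" for t
  proof -
    have tT: "t < T" using t r0 by (simp add: r0_def)
    have "(\<integral>\<^sup>+ y\<in>half_closed k. ennreal (u y t * \<phi> y) \<partial>lborel)
      = (\<integral>\<^sup>+ x. ennreal (\<phi> x) * (\<integral>\<^sup>+ y. ennreal (neumann_kernel k x y t) * indicator (half_closed k) y \<partial>\<mu>) * indicator (half_closed k) x
        + ennreal (\<phi> x) * (\<integral>\<^sup>+ m. ennreal (neumann_kernel k x (snd m) (t - fst m)) * (?F m * indicator {0..t} (fst m)) \<partial>?N)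
          * indicator (half_closed k) x \<partial>lborel)"
    proof (rule nn_integral_cong)
      fix x :: "real^'n"
      show "ennreal (u x t * \<phi> x) * indicator (half_closed k) x =
         ennreal (\<phi> x) * (\<integral>\<^sup>+ y. ennreal (neumann_kernel k x y t) * indicator (half_closed k) y \<partial>\<mu>) * indicator (half_closed k) x
        + ennreal (\<phi> x) * (\<integral>\<^sup>+ m. ennreal (neumann_kernel k x (snd m) (t - fst m)) * (?F m * indicator {0..t} (fst m)) \<partial>?N)
          * indicator (half_closed k) x"
      proof (cases "x \<in> half_closed k")
        case True
        have "ennreal (u x t * \<phi> x) = ennreal (\<phi> x) * ennreal (u x t)"
          using \<phi>(1)[of x] by (subst mult.commute) (rule ennreal_mult')
        with True eq[of x t] duhamel_bdry_eq[OF adm, of 0 t p x] t tT show ?thesis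
          by (simp add: distrib_left)
      qed simp
    qed
    also have "\<dots> = (\<integral>\<^sup>+ x. ennreal (\<phi> x) * (\<integral>\<^sup>+ y. ennreal (neumann_kernel k x y t) * indicator (half_closed k) y \<partial>\<mu>) * indicator (half_closed k) x \<partial>lborel)
        + (\<integral>\<^sup>+ x. ennreal (\<phi> x) * (\<integral>\<^sup>+ m. ennreal (neumann_kernel k x (snd m) (t - fst m)) * (?F m * indicator {0..t} (fst m)) \<partial>?N)
          * indicator (half_closed k) x \<partial>lborel)"
      by (rule nn_integral_add) measurable
    also have "\<dots> = (\<integral>\<^sup>+ y. adjoint_avg k t \<phi> y * indicator (half_closed k) y \<partial>\<mu>)
        + (\<integral>\<^sup>+ m. adjoint_avg k (t - fst m) \<phi> (snd m) * (?F m * indicator {0..t} (fst m)) \<partial>?N)"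
      using \<phi>(1)
      by (intro arg_cong2[where f = "(+)"] nn_integral_adjoint_avg mu.sigma_finite_measure_axioms sigma_finite_measure_axioms) auto
    finally show ?thesis .
  qed
  show ?thesis
  proof (rule tendsto_at_right_sequentially[OF r0])
    fix S :: "nat \<Rightarrow> real" assume S: "\<And>n. 0 < S n" "\<And>n. S n < r0" "S \<longlonglongrightarrow> 0"
    have lim_initial: "(\<lambda>n. \<integral>\<^sup>+ y. adjoint_avg k (S n) \<phi> y * indicator (half_closed k) y \<partial>\<mu>)
       \<longlonglongrightarrow> (\<integral>\<^sup>+ y. ennreal (\<phi> y) * indicator (half_closed k) y \<partial>\<mu>)"
    proof (rule nn_integral_dominated_convergence)
      \<comment> \<open>The kernel bound with the fixed time \<open>q = 8 * r0\<close>.\<close>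
      let ?w = "\<lambda>y. ennreal C * (ennreal (neumann_kernel k 0 y (8 * r0)) * indicator (half_closed k) y)"
      show "(\<integral>\<^sup>+ y. ?w y \<partial>\<mu>) < \<infinity>"
        using fin(1) by (simp add: nn_integral_cmult ennreal_mult_less_top)
      show "AE y in \<mu>. adjoint_avg k (S j) \<phi> y * indicator (half_closed k) y \<le> ?w y" for j
        using C(2)[of "S j" "8 * r0"] S[of] r0 C(1) less_imp_le[OF S(2)[of j]]
        by (intro AE_I2) (auto simp: indicator_def ennreal_mult)
      have "(\<lambda>n. adjoint_avg k (S n) \<phi> y) \<longlonglongrightarrow> ennreal (\<phi> y)" if "y \<in> half_closed k" for y
      proof (rule filterlim_compose[OF adjoint_avg_tendsto[OF cont \<phi>(1,2) that]])
        show "filterlim S (at_right 0) sequentially"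
          using S less_imp_neq[OF S(1), symmetric] by (simp add: filterlim_at)
      qed
      thus "AE y in \<mu>. (\<lambda>n. adjoint_avg k (S n) \<phi> y * indicator (half_closed k) y)
          \<longlonglongrightarrow> ennreal (\<phi> y) * indicator (half_closed k) y"
        by (intro AE_I2) (auto simp: indicator_def)
    qed measurable
    have lim_bdry: "(\<lambda>n. \<integral>\<^sup>+ m. adjoint_avg k (S n - fst m) \<phi> (snd m) * (?F m * indicator {0..S n} (fst m)) \<partial>?N)
       \<longlonglongrightarrow> (\<integral>\<^sup>+ m. 0 \<partial>?N)"
    proof (rule nn_integral_dominated_convergence)
      \<comment> \<open>Here \<open>q = 8 * r0 - s\<close> varies with the source time
        \<open>s\<close>, so that the dominating function is the integrand of the Duhamel term at
        the origin.\<close>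
      let ?w = "\<lambda>m. ennreal C * (ennreal (neumann_kernel k 0 (snd m) (8 * r0 - fst m)) * (?F m * indicator {0..8 * r0} (fst m)))"
      show "(\<integral>\<^sup>+ m. ?w m \<partial>?N) < \<infinity>"
        using fin(2) by (simp add: nn_integral_cmult ennreal_mult_less_top)
      show "AE m in ?N. adjoint_avg k (S j - fst m) \<phi> (snd m) * (?F m * indicator {0..S j} (fst m)) \<le> ?w m" for j
      proof (rule AE_I2)
        fix m :: "real \<times> (real^'n)"
        show "adjoint_avg k (S j - fst m) \<phi> (snd m) * (?F m * indicator {0..S j} (fst m)) \<le> ?w m"
        proof (cases "0 \<le> fst m \<and> fst m \<le> S j")
          case True
          have "adjoint_avg k (S j - fst m) \<phi> (snd m) \<le> ennreal (C * neumann_kernel k 0 (snd m) (8 * r0 - fst m))"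
          proof (cases "fst m = S j")
            case True
            \<comment> \<open>At zero elapsed time the kernel is 0 because its prefactor is a power
              of 0, so the average vanishes.\<close>
            thus ?thesis by (simp add: adjoint_avg_def neumann_kernel_def heat_kernel_def)
          next
            case False
            thus ?thesis using True S(1,2)[of j] r0 by (intro C(2)) auto
          qed
          with True S(2)[of j] r0 C(1) show ?thesis
            by (auto simp: indicator_def ennreal_mult mult.assoc[symmetric] intro!: mult_right_mono)
        qed auto
      qed
      \<comment> \<open>Each positive source time eventually leaves the shrinking interval, and at
        nonpositive times the flux is 0.\<close>
      have "(\<lambda>n. adjoint_avg k (S n - fst m) \<phi> (snd m) * (?F m * indicator {0..S n} (fst m))) \<longlonglongrightarrow> 0" for m
      proof (cases "fst m \<le> 0")
        case False
        hence "\<forall>\<^sub>F n in sequentially. S n < fst m"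
          using S(3) by (intro order_tendstoD(2)) auto
        thus ?thesis by (intro tendsto_eventually) (auto elim!: eventually_mono)
      qed (simp add: bdry_flux_time_0)
      thus "AE m in ?N. (\<lambda>n. adjoint_avg k (S n - fst m) \<phi> (snd m) * (?F m * indicator {0..S n} (fst m))) \<longlonglongrightarrow> 0"
        by simp
    qed measurable
    from tendsto_add[OF lim_initial lim_bdry]
    show "(\<lambda>n. \<integral>\<^sup>+ y\<in>half_closed k. ennreal (u y (S n) * \<phi> y) \<partial>lborel)
       \<longlonglongrightarrow> (\<integral>\<^sup>+ y\<in>half_closed k. ennreal (\<phi> y) \<partial>\<mu>)"
      unfolding split[OF S(1,2)] by simp
  qed
qed

text \<open>Positive and negative parts of \<open>\<phi>\<close> are again continuous with bounded
  support, so the nonnegative case applies to each and integrability permits subtraction.\<close>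

lemma initial_trace:
  fixes u :: "real^'n::finite \<Rightarrow> real \<Rightarrow> real" and \<phi> :: "real^'n \<Rightarrow> real"
  assumes T: "0 < T" and radon: "radon_measure \<mu>"
    and sol: "initial_boundary_problem_solution k p T \<mu> u" and \<phi>: "\<phi> \<in> C0"
  shows "((\<lambda>t. LINT y:half_closed k|lborel. u y t * \<phi> y) \<longlongrightarrow> (LINT y:half_closed k|\<mu>. \<phi> y)) (at_right 0)"
proof -
  have adm: "admissible k T u"
    using sol by (simp add: initial_boundary_problem_solution_def)
  have cont: "continuous_on UNIV \<phi>" using \<phi> by (simp add: C0_def)
  obtain R M where R: "\<And>x. R < norm x \<Longrightarrow> \<phi> x = 0" and M: "\<And>x. \<bar>\<phi> x\<bar> \<le> M"
    using C0_bounded_support[OF \<phi>] by metis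
  have nonneg: "((\<lambda>t. LINT y:half_closed k|lborel. u y t * \<psi> y) \<longlongrightarrow> (LINT y:half_closed k|\<mu>. \<psi> y)) (at_right 0)"
    if \<psi>: "continuous_on UNIV \<psi>" "\<And>x. 0 \<le> \<psi> x" "\<And>x. \<psi> x \<le> M" "\<And>x. R < norm x \<Longrightarrow> \<psi> x = 0" for \<psi>
  proof -
    have C0: "\<psi> \<in> C0" using C0I[of \<psi> R 0] \<psi>(1,4) by simp
    have ev: "\<forall>\<^sub>F t in at_right 0. 0 < t \<and> t < T"
      using eventually_at_right_real[OF T] by simp
    have eq: "(\<integral>\<^sup>+ y\<in>half_closed k. ennreal (u y t * \<psi> y) \<partial>lborel) = ennreal (LINT y:half_closed k|lborel. u y t * \<psi> y)"
      if "0 < t \<and> t < T" for t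
      using adm that \<psi>(2)
      by (intro set_nn_integral_eq_set_integral set_integrable_slice_C0[OF adm _ _ C0]) (auto simp: admissible_def)
    have "((\<lambda>t. \<integral>\<^sup>+ y\<in>half_closed k. ennreal (u y t * \<psi> y) \<partial>lborel)
        \<longlongrightarrow> ennreal (LINT y:half_closed k|\<mu>. \<psi> y)) (at_right 0)"
      using initial_trace_nonneg[OF T radon sol \<psi>]
      by (simp add: set_nn_integral_eq_set_integral[OF set_integrable_radon_C0[OF radon C0]] \<psi>(2))
    hence lim: "((\<lambda>t. ennreal (LINT y:half_closed k|lborel. u y t * \<psi> y))
        \<longlongrightarrow> ennreal (LINT y:half_closed k|\<mu>. \<psi> y)) (at_right 0)"
      by (rule Lim_transform_eventually[OF _ eventually_mono[OF ev eq]])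
    have int_nonneg: "0 \<le> (LINT y:half_closed k|\<mu>. \<psi> y)"
      unfolding set_lebesgue_integral_def using \<psi>(2) by (intro integral_nonneg_AE) auto
    \<comment> \<open>\<open>ennreal\<close> truncates negative numbers, so returning to real limits
      requires nonnegativity of both sides.\<close>
    have "\<forall>\<^sub>F t in at_right 0. 0 \<le> (LINT y:half_closed k|lborel. u y t * \<psi> y)"
      using ev
    proof eventually_elim
      case (elim t)
      thus ?case unfolding set_lebesgue_integral_def using \<psi>(2) adm
        by (intro integral_nonneg_AE) (auto simp: indicator_def admissible_def)
    qed
    from tendsto_ennrealD[OF lim this int_nonneg] show ?thesis .
  qed
  define \<phi>p \<phi>m where "\<phi>p x = max 0 (\<phi> x)" and "\<phi>m x = max 0 (- \<phi> x)" for x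
  have bounds: "\<phi> x \<le> M" "- \<phi> x \<le> M" "0 \<le> M" for x
    using M[of x] by simp_all
  have p: "continuous_on UNIV \<phi>p" "\<And>x. 0 \<le> \<phi>p x" "\<And>x. \<phi>p x \<le> M" "\<And>x. R < norm x \<Longrightarrow> \<phi>p x = 0"
    using bounds R by (auto simp: \<phi>p_def[abs_def] intro!: continuous_on_max continuous_on_minus continuous_on_const cont)
  have m: "continuous_on UNIV \<phi>m" "\<And>x. 0 \<le> \<phi>m x" "\<And>x. \<phi>m x \<le> M" "\<And>x. R < norm x \<Longrightarrow> \<phi>m x = 0"
    using bounds R by (auto simp: \<phi>m_def[abs_def] intro!: continuous_on_max continuous_on_minus continuous_on_const cont)
  have C0p: "\<phi>p \<in> C0" and C0m: "\<phi>m \<in> C0"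
    by (rule C0I[of _ R 0]; simp add: p m)+
  have split: "\<phi> y = \<phi>p y - \<phi>m y" for y by (simp add: \<phi>p_def \<phi>m_def)
  have "((\<lambda>t. (LINT y:half_closed k|lborel. u y t * \<phi>p y) - (LINT y:half_closed k|lborel. u y t * \<phi>m y))
     \<longlongrightarrow> (LINT y:half_closed k|\<mu>. \<phi>p y) - (LINT y:half_closed k|\<mu>. \<phi>m y)) (at_right 0)"
    by (intro tendsto_diff nonneg p m)
  also have "(LINT y:half_closed k|\<mu>. \<phi>p y) - (LINT y:half_closed k|\<mu>. \<phi>m y) = (LINT y:half_closed k|\<mu>. \<phi> y)"
    unfolding split by (intro set_integral_diff(2)[symmetric] set_integrable_radon_C0[OF radon] C0p C0m)
  finally show ?thesis
  proof (rule Lim_transform_eventually)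
    show "\<forall>\<^sub>F t in at_right 0. (LINT y:half_closed k|lborel. u y t * \<phi>p y) - (LINT y:half_closed k|lborel. u y t * \<phi>m y)
        = (LINT y:half_closed k|lborel. u y t * \<phi> y)"
      using eventually_at_right_real[OF T]
    proof eventually_elim
      case (elim t)
      hence t: "0 < t" "t < T" by auto
      show ?case unfolding split right_diff_distrib
        by (intro set_integral_diff(2)[symmetric] set_integrable_slice_C0[OF adm t] C0p C0m)
    qed
  qed
qed

section \<open>Solutions with a prescribed initial trace\<close>

text \<open>The exact quotient of two kernels. For \<open>s \<le> t\<close> its power factor is at
  least 1 and its exponent decreases in \<open>norm w\<close>; the two bounds that follow freeze the
  norm at an upper or a lower bound.\<close>

lemma heat_kernel_change_time:
  assumes "0 < s" "0 < t"
  shows "heat_kernel N w s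
      = (t / s) powr (real N / 2) * exp (- ((norm w)\<^sup>2 / 4) * (1 / s - 1 / t)) * heat_kernel N w t"
proof -
  have "(4 * pi * t) powr (- real N / 2) = (t / s * (4 * pi * s)) powr (- real N / 2)"
    using assms by (simp add: mult_ac)
  also have "\<dots> = (t / s) powr (- real N / 2) * (4 * pi * s) powr (- real N / 2)"
    by (rule powr_mult)
  finally have "(t / s) powr (real N / 2) * (4 * pi * t) powr (- real N / 2)
      = ((t / s) powr (real N / 2) * (t / s) powr (- real N / 2)) * (4 * pi * s) powr (- real N / 2)"
    by simp
  also have "(t / s) powr (real N / 2) * (t / s) powr (- real N / 2) = 1"
    using assms by (simp flip: powr_add)
  finally have 1: "(t / s) powr (real N / 2) * (4 * pi * t) powr (- real N / 2) = (4 * pi * s) powr (- real N / 2)"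
    by simp
  have "- ((norm w)\<^sup>2 / 4) * (1 / s - 1 / t) + - (norm w)\<^sup>2 / (4 * t) = - (norm w)\<^sup>2 / (4 * s)"
    by (simp add: right_diff_distrib)
  hence 2: "exp (- ((norm w)\<^sup>2 / 4) * (1 / s - 1 / t)) * exp (- (norm w)\<^sup>2 / (4 * t)) = exp (- (norm w)\<^sup>2 / (4 * s))"
    by (simp only: exp_add[symmetric])
  show ?thesis unfolding heat_kernel_def 1[symmetric] 2[symmetric] by (simp only: mult_ac)
qed

lemma heat_kernel_earlier_ge:
  assumes "0 < s" "s \<le> t" "norm w \<le> b"
  shows "exp (- (b\<^sup>2 / 4) * (1 / s - 1 / t)) * heat_kernel N w t \<le> heat_kernel N w s"
proof -
  have "((norm w)\<^sup>2 / 4) * (1 / s - 1 / t) \<le> (b\<^sup>2 / 4) * (1 / s - 1 / t)"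
    using assms by (intro mult_right_mono) (auto simp: power_mono frac_le)
  hence "exp (- (b\<^sup>2 / 4) * (1 / s - 1 / t)) \<le> exp (- ((norm w)\<^sup>2 / 4) * (1 / s - 1 / t))"
    by simp
  moreover have "1 \<le> (t / s) powr (real N / 2)"
    using assms by (intro ge_one_powr_ge_zero) auto
  ultimately have "1 * exp (- (b\<^sup>2 / 4) * (1 / s - 1 / t))
      \<le> (t / s) powr (real N / 2) * exp (- ((norm w)\<^sup>2 / 4) * (1 / s - 1 / t))"
    by (intro mult_mono) auto
  thus ?thesis using assms
    by (subst heat_kernel_change_time[of s t]) (auto intro: mult_right_mono)
qed

lemma heat_kernel_earlier_le:
  assumes "0 < s" "s \<le> t" "0 \<le> R" "R \<le> norm w"
  shows "heat_kernel N w s \<le> (t / s) powr (real N / 2) * exp (- (R\<^sup>2 / 4) * (1 / s - 1 / t)) * heat_kernel N w t"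
proof -
  have "(R\<^sup>2 / 4) * (1 / s - 1 / t) \<le> ((norm w)\<^sup>2 / 4) * (1 / s - 1 / t)"
    using assms by (intro mult_right_mono) (auto simp: power_mono frac_le)
  hence "exp (- ((norm w)\<^sup>2 / 4) * (1 / s - 1 / t)) \<le> exp (- (R\<^sup>2 / 4) * (1 / s - 1 / t))"
    by simp
  thus ?thesis using assms
    by (subst heat_kernel_change_time[of s t]) (auto intro!: mult_right_mono mult_left_mono)
qed

lemma continuous_on_heat_kernel [continuous_intros]:
  "0 < t \<Longrightarrow> continuous_on S f \<Longrightarrow> continuous_on S (\<lambda>x. heat_kernel N (f x) t)"
  unfolding heat_kernel_def by (intro continuous_intros) auto

text \<open>Along a decreasing sequence of starting times the intervals grow, so monotone
  convergence applies; the missing time 0 carries no flux.\<close>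

lemma duhamel_bdry_tendsto:
  assumes adm: "admissible k T u" and t: "0 < t" "t < T"
  shows "((\<lambda>\<tau>. duhamel_bdry k p u x \<tau> t) \<longlongrightarrow> duhamel_bdry k p u x 0 t) (at_right 0)"
proof (rule tendsto_at_right_sequentially[OF t(1)])
  fix S :: "nat \<Rightarrow> real" assume S: "\<And>n. 0 < S n" "\<And>n. S n < t" "decseq S" "S \<longlonglongrightarrow> 0"
  note [measurable] = borel_measurable_bdry_flux[OF adm]
  let ?g = "\<lambda>a m. ennreal (neumann_kernel k x (snd m) (t - fst m)) * (bdry_flux k p T u m * indicator {a..t} (fst m))"
  have "(\<lambda>n. integral\<^sup>N (lborel \<Otimes>\<^sub>M bdry_measure k) (?g (S n))) \<longlonglongrightarrow> integral\<^sup>N (lborel \<Otimes>\<^sub>M bdry_measure k) (?g 0)"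
  proof (rule nn_integral_LIMSEQ)
    show "incseq (\<lambda>n. ?g (S n))"
      using S(3) by (auto simp: incseq_def le_fun_def decseq_def indicator_def intro!: mult_left_mono intro: order_trans)
    show "(\<lambda>n. ?g (S n) m) \<longlonglongrightarrow> ?g 0 m" for m
    proof (cases "fst m \<le> 0")
      case False
      hence "\<forall>\<^sub>F n in sequentially. S n < fst m"
        using S(4) by (intro order_tendstoD(2)) auto
      hence "\<forall>\<^sub>F n in sequentially. ?g (S n) m = ?g 0 m"
        by eventually_elim (use False in \<open>auto simp: indicator_def\<close>)
      thus ?thesis by (rule tendsto_eventually)
    qed (simp add: bdry_flux_time_0)
  qed measurable
  thus "(\<lambda>n. duhamel_bdry k p u x (S n) t) \<longlonglongrightarrow> duhamel_bdry k p u x 0 t"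
    using duhamel_bdry_eq[OF adm _ t(2), of _ p x] less_imp_le[OF S(1)] by simp
qed

lemma neumann_kernel_earlier_ge:
  fixes x y :: "real^'n::finite"
  assumes "0 < s" "s \<le> t" "norm x + norm y \<le> b"
  shows "exp (- (b\<^sup>2 / 4) * (1 / s - 1 / t)) * neumann_kernel k x y t \<le> neumann_kernel k x y s"
proof -
  have "norm (x - y) \<le> b" "norm (x - reflect k y) \<le> b"
    using norm_triangle_ineq4[of x y] norm_triangle_ineq4[of x "reflect k y"] assms(3) by simp_all
  thus ?thesis unfolding neumann_kernel_def distrib_left
    using assms by (intro add_mono heat_kernel_earlier_ge)
qed

lemma neumann_kernel_earlier_le:
  fixes x y :: "real^'n::finite"
  assumes "0 < s" "s \<le> t" "0 \<le> R" "R \<le> norm (x - y)" "x \<in> half_closed k" "y \<in> half_closed k"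
  shows "neumann_kernel k x y s
     \<le> (t / s) powr (real CARD('n) / 2) * exp (- (R\<^sup>2 / 4) * (1 / s - 1 / t)) * neumann_kernel k x y t"
proof -
  have "R \<le> norm (x - reflect k y)"
    using norm_diff_le_reflect[OF assms(5,6)] assms(4) by simp
  thus ?thesis unfolding neumann_kernel_def distrib_left
    using assms by (intro add_mono heat_kernel_earlier_le)
qed

text \<open>The condition \<open>\<tau> \<le> t / 2\<close> removes \<open>\<tau>\<close> from the
  constants. Since \<open>t'\<close> exceeds \<open>t\<close> strictly, the factor tends to 0 as
  \<open>R\<close> grows, uniformly in \<open>\<tau>\<close>.\<close>

lemma neumann_kernel_far_le_uniform:
  fixes x y :: "real^'n::finite"
  assumes "0 < t" "t < t'" "0 < \<tau>" "\<tau> \<le> t / 2" "0 \<le> R" "R \<le> norm (x - y)"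
    and "x \<in> half_closed k" "y \<in> half_closed k"
  shows "neumann_kernel k x y (t - \<tau>)
     \<le> (2 * t' / t) powr (real CARD('n) / 2) * exp (- (R\<^sup>2 / 4) * ((t' - t) / (t * t'))) * neumann_kernel k x y (t' - \<tau>)"
proof -
  have "(t' - \<tau>) / (t - \<tau>) \<le> t' / (t / 2)"
    using assms by (intro frac_le) auto
  hence p: "((t' - \<tau>) / (t - \<tau>)) powr (real CARD('n) / 2) \<le> (2 * t' / t) powr (real CARD('n) / 2)"
    using assms by (intro powr_mono2) (auto simp: mult.commute)
  have "(t' - t) / (t * t') \<le> (t' - t) / ((t - \<tau>) * (t' - \<tau>))"
    using assms by (intro divide_left_mono mult_mono) auto
  also have "\<dots> = 1 / (t - \<tau>) - 1 / (t' - \<tau>)"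
    using assms by (simp add: diff_frac_eq)
  finally have "(R\<^sup>2 / 4) * ((t' - t) / (t * t')) \<le> (R\<^sup>2 / 4) * (1 / (t - \<tau>) - 1 / (t' - \<tau>))"
    by (rule mult_left_mono) simp
  hence e: "exp (- (R\<^sup>2 / 4) * (1 / (t - \<tau>) - 1 / (t' - \<tau>))) \<le> exp (- (R\<^sup>2 / 4) * ((t' - t) / (t * t')))"
    by simp
  have "neumann_kernel k x y (t - \<tau>) \<le> ((t' - \<tau>) / (t - \<tau>)) powr (real CARD('n) / 2)
      * exp (- (R\<^sup>2 / 4) * (1 / (t - \<tau>) - 1 / (t' - \<tau>))) * neumann_kernel k x y (t' - \<tau>)"
    using assms by (intro neumann_kernel_earlier_le) auto
  also have "\<dots> \<le> (2 * t' / t) powr (real CARD('n) / 2)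
      * exp (- (R\<^sup>2 / 4) * ((t' - t) / (t * t'))) * neumann_kernel k x y (t' - \<tau>)"
    using p e by (intro mult_right_mono mult_mono) auto
  finally show ?thesis .
qed

text \<open>For fixed \<open>x\<close> and \<open>t\<close> the term starting at
  \<open>\<tau>\<close> is squeezed between multiples of the pairing of \<open>u\<close> with a
  truncated kernel, up to a tail. First \<open>\<tau>\<close> tends to 0 at a fixed truncation level
  \<open>n\<close>, where the trace condition applies; only then does \<open>n\<close> tend to
  infinity.\<close>

lemma boundary_problem_imp_initial_boundary_problem:
  fixes u :: "real^'n::finite \<Rightarrow> real \<Rightarrow> real"
  assumes radon: "radon_measure \<mu>"
    and sol: "boundary_problem_solution k p T u"
    and trace: "\<And>\<phi>. \<phi> \<in> C0 \<Longrightarrow>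
      ((\<lambda>t. LINT y:half_closed k|lborel. u y t * \<phi> y) \<longlongrightarrow> (LINT y:half_closed k|\<mu>. \<phi> y)) (at_right 0)"
  shows "initial_boundary_problem_solution k p T \<mu> u"
proof -
  have adm: "admissible k T u"
    and eq: "\<And>\<tau> x t. 0 < \<tau> \<Longrightarrow> \<tau> < t \<Longrightarrow> t < T \<Longrightarrow> x \<in> half_closed k \<Longrightarrow> ennreal (u x t) =
          (\<integral>\<^sup>+ y\<in>half_closed k. ennreal (neumann_kernel k x y (t - \<tau>) * u y \<tau>) \<partial>lborel) + duhamel_bdry k p u x \<tau> t"
    using sol unfolding boundary_problem_solution_def by auto
  have u_nonneg: "0 \<le> u y \<tau>" if "y \<in> half_closed k" "0 < \<tau>" "\<tau> < T" for y \<tau>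
    using adm that by (auto simp: admissible_def)
  have [measurable_cong]: "sets \<mu> = sets borel" using radon by (simp add: radon_measure_def)
  have "ennreal (u x t) = (\<integral>\<^sup>+ y\<in>half_closed k. ennreal (neumann_kernel k x y t) \<partial>\<mu>) + duhamel_bdry k p u x 0 t"
    if x: "x \<in> half_closed k" and t: "0 < t" "t < T" for x t
  proof -
    define t' where "t' = (t + T) / 2"
    have t': "t < t'" "t' < T" using t by (simp_all add: t'_def)
    \<comment> \<open>Equal to 1 up to distance \<open>n\<close> from \<open>x\<close> and to 0 from
      distance \<open>n + 1\<close> on; hence \<open>\<psi> n\<close> is a test function and
      increases to the kernel with \<open>n\<close>.\<close>
    define cut where "cut n y = max 0 (min 1 (real n + 1 - norm (x - y)))" for n :: nat and y :: "real^'n"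
    define \<psi> where "\<psi> n y = neumann_kernel k x y t * cut n y" for n y
    define \<alpha> where "\<alpha> n \<tau> = (LINT y:half_closed k|lborel. u y \<tau> * \<psi> n y)" for n \<tau>
    define A where "A n = (LINT y:half_closed k|\<mu>. \<psi> n y)" for n
    \<comment> \<open>The factors \<open>c \<tau>\<close> and \<open>d n \<tau>\<close> tend to 1
      with \<open>\<tau>\<close>; \<open>e n\<close> is free of \<open>\<tau>\<close> and tends to 0
      with \<open>n\<close>. The radius in \<open>d\<close> bounds \<open>norm x + norm y\<close> on
      the support of the cutoff.\<close>
    define c where "c \<tau> = (t / (t - \<tau>)) powr (real CARD('n) / 2)" for \<tau>
    define d where "d n \<tau> = exp (- ((2 * norm x + real n + 1)\<^sup>2 / 4) * (1 / (t - \<tau>) - 1 / t))" for n :: nat and \<tau>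
    define e where "e n = (2 * t' / t) powr (real CARD('n) / 2) * exp (- ((real n)\<^sup>2 / 4) * ((t' - t) / (t * t')))" for n :: nat
    define I where "I \<tau> = (\<integral>\<^sup>+ y\<in>half_closed k. ennreal (neumann_kernel k x y (t - \<tau>) * u y \<tau>) \<partial>lborel)" for \<tau>
    let ?D = "\<lambda>\<tau>. duhamel_bdry k p u x \<tau> t"
    have cut: "0 \<le> cut n y" "cut n y \<le> 1" for n y by (auto simp: cut_def)
    have \<psi>_nonneg: "0 \<le> \<psi> n y" for n y by (simp add: \<psi>_def cut)
    have \<psi>_C0: "\<psi> n \<in> C0" for n
    proof (rule C0I)
      show "continuous_on UNIV (\<psi> n)"
        unfolding \<psi>_def cut_def neumann_kernel_def using t by (intro continuous_intros)
      show "\<psi> n y = 0" if "real n + 1 < norm (y - x)" for y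
        using that by (simp add: \<psi>_def cut_def norm_minus_commute)
    qed
    have upper: "neumann_kernel k x y (t - \<tau>) \<le> c \<tau> * \<psi> n y + e n * neumann_kernel k x y (t' - \<tau>)"
      if "0 < \<tau>" "\<tau> \<le> t / 2" "y \<in> half_closed k" for \<tau> y n
    proof (cases "norm (x - y) \<le> real n")
      case True
      hence "\<psi> n y = neumann_kernel k x y t" by (simp add: \<psi>_def cut_def)
      moreover have "neumann_kernel k x y (t - \<tau>) \<le> c \<tau> * neumann_kernel k x y t"
        \<comment> \<open>With distance bound 0 the exponential factor is 1 and only
          \<open>c \<tau>\<close> remains.\<close>
        using neumann_kernel_earlier_le[of "t - \<tau>" t 0 x y k] that x t by (simp add: c_def)
      moreover have "0 \<le> e n * neumann_kernel k x y (t' - \<tau>)" by (simp add: e_def)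
      ultimately show ?thesis by simp
    next
      case False
      have "neumann_kernel k x y (t - \<tau>) \<le> e n * neumann_kernel k x y (t' - \<tau>)"
        unfolding e_def using False that x t t' by (intro neumann_kernel_far_le_uniform) auto
      moreover have "0 \<le> c \<tau> * \<psi> n y" using \<psi>_nonneg by (simp add: c_def)
      ultimately show ?thesis by simp
    qed
    have lower: "d n \<tau> * \<psi> n y \<le> neumann_kernel k x y (t - \<tau>)" if "0 < \<tau>" "\<tau> \<le> t / 2" for \<tau> y n
    proof (cases "norm (x - y) \<le> real n + 1")
      case True
      have "norm y \<le> norm x + norm (x - y)"
        using norm_triangle_ineq4[of x "x - y"] by simp
      hence "d n \<tau> * neumann_kernel k x y t \<le> neumann_kernel k x y (t - \<tau>)"
        unfolding d_def using True that t by (intro neumann_kernel_earlier_ge) auto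
      moreover have "d n \<tau> * \<psi> n y \<le> d n \<tau> * neumann_kernel k x y t"
        unfolding \<psi>_def by (intro mult_left_mono mult_right_le_one_le cut) (auto simp: d_def)
      ultimately show ?thesis by simp
    qed (simp add: \<psi>_def cut_def)
    have \<alpha>_eq: "(\<integral>\<^sup>+ y\<in>half_closed k. ennreal (u y \<tau> * \<psi> n y) \<partial>lborel) = ennreal (\<alpha> n \<tau>)"
      if "0 < \<tau>" "\<tau> \<le> t / 2" for n \<tau>
      unfolding \<alpha>_def using that t u_nonneg \<psi>_nonneg
      by (intro set_nn_integral_eq_set_integral set_integrable_slice_C0[OF adm _ _ \<psi>_C0]) auto
    have A_eq: "(\<integral>\<^sup>+ y\<in>half_closed k. ennreal (\<psi> n y) \<partial>\<mu>) = ennreal (A n)" for n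
      unfolding A_def using \<psi>_nonneg
      by (intro set_nn_integral_eq_set_integral set_integrable_radon_C0[OF radon \<psi>_C0])
    \<comment> \<open>The values of \<open>u\<close> off the half space are arbitrary, so
      measurability is taken from the zero extension.\<close>
    have slice: "(\<lambda>y. u y \<tau> * indicator (half_closed k) y) \<in> borel_measurable borel" if "0 < \<tau>" "\<tau> < T" for \<tau>
    proof -
      have "(\<lambda>y. zero_ext k T u y \<tau>) \<in> borel_measurable borel"
        using measurable_compose[OF measurable_Pair2' borel_measurable_zero_ext[OF adm], of \<tau>] by simp
      also have "(\<lambda>y. zero_ext k T u y \<tau>) = (\<lambda>y. u y \<tau> * indicator (half_closed k) y)"
        using that by (auto simp: zero_ext_def indicator_def)
      finally show ?thesis .
    qed
    have [measurable]: "\<psi> n \<in> borel_measurable borel" for n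
      using \<psi>_C0[of n] by (auto simp: C0_def intro: borel_measurable_continuous_onI)
    have I_upper: "I \<tau> \<le> ennreal (c \<tau> * \<alpha> n \<tau>) + ennreal (e n * u x t')"
      if \<tau>: "0 < \<tau>" "\<tau> \<le> t / 2" for n \<tau>
    proof -
      have \<tau>T: "\<tau> < T" "\<tau> < t'" using \<tau> t t' by simp_all
      note [measurable] = slice[OF \<tau>(1) \<tau>T(1)]
      let ?w = "\<lambda>y. u y \<tau> * indicator (half_closed k) y"
      have w: "0 \<le> ?w y" for y using u_nonneg \<tau>(1) \<tau>T(1) by (simp add: indicator_def)
      have "I \<tau> \<le> (\<integral>\<^sup>+ y. ennreal (c \<tau>) * ennreal (?w y * \<psi> n y) + ennreal (e n) * ennreal (neumann_kernel k x y (t' - \<tau>) * ?w y) \<partial>lborel)"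
        unfolding I_def
      proof (rule nn_integral_mono)
        fix y :: "real^'n"
        show "ennreal (neumann_kernel k x y (t - \<tau>) * u y \<tau>) * indicator (half_closed k) y
            \<le> ennreal (c \<tau>) * ennreal (?w y * \<psi> n y) + ennreal (e n) * ennreal (neumann_kernel k x y (t' - \<tau>) * ?w y)"
        proof (cases "y \<in> half_closed k")
          case True
          have "neumann_kernel k x y (t - \<tau>) * u y \<tau> \<le> (c \<tau> * \<psi> n y + e n * neumann_kernel k x y (t' - \<tau>)) * u y \<tau>"
            using upper[OF \<tau> True] u_nonneg[OF True \<tau>(1) \<tau>T(1)] by (intro mult_right_mono)
          also have "\<dots> = c \<tau> * (u y \<tau> * \<psi> n y) + e n * (neumann_kernel k x y (t' - \<tau>) * u y \<tau>)"
            by (simp add: algebra_simps)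
          finally show ?thesis
            using True u_nonneg[OF True \<tau>(1) \<tau>T(1)] \<psi>_nonneg[of n y]
            by (simp add: c_def e_def ennreal_leI flip: ennreal_mult ennreal_plus)
        qed simp
      qed
      also have "\<dots> = ennreal (c \<tau>) * (\<integral>\<^sup>+ y. ennreal (?w y * \<psi> n y) \<partial>lborel)
          + ennreal (e n) * (\<integral>\<^sup>+ y. ennreal (neumann_kernel k x y (t' - \<tau>) * ?w y) \<partial>lborel)"
        by (simp add: nn_integral_add nn_integral_cmult)
      also have "(\<integral>\<^sup>+ y. ennreal (?w y * \<psi> n y) \<partial>lborel) = ennreal (\<alpha> n \<tau>)"
        unfolding \<alpha>_eq[OF \<tau>, symmetric] by (intro nn_integral_cong) (simp add: indicator_def)
      \<comment> \<open>The equation at the later time \<open>t'\<close> with its nonnegative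
        Duhamel term dropped; this bounds the tail independently of \<open>\<tau>\<close>.\<close>
      also have "(\<integral>\<^sup>+ y. ennreal (neumann_kernel k x y (t' - \<tau>) * ?w y) \<partial>lborel) \<le> ennreal (u x t')"
      proof -
        have "(\<integral>\<^sup>+ y. ennreal (neumann_kernel k x y (t' - \<tau>) * ?w y) \<partial>lborel)
            = (\<integral>\<^sup>+ y\<in>half_closed k. ennreal (neumann_kernel k x y (t' - \<tau>) * u y \<tau>) \<partial>lborel)"
          by (intro nn_integral_cong) (simp add: indicator_def)
        thus ?thesis using eq[OF \<tau>(1) \<tau>T(2) t'(2) x] by simp
      qed
      finally show ?thesis
        by (simp add: c_def e_def ennreal_mult' mult_left_mono add_left_mono)
    qed
    have I_lower: "ennreal (d n \<tau> * \<alpha> n \<tau>) \<le> I \<tau>" if \<tau>: "0 < \<tau>" "\<tau> \<le> t / 2" for n \<tau>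
    proof -
      have \<tau>T: "\<tau> < T" using \<tau> t by simp
      note [measurable] = slice[OF \<tau>(1) \<tau>T]
      have "ennreal (d n \<tau> * \<alpha> n \<tau>) = ennreal (d n \<tau>) * (\<integral>\<^sup>+ y\<in>half_closed k. ennreal (u y \<tau> * \<psi> n y) \<partial>lborel)"
        unfolding \<alpha>_eq[OF \<tau>] by (simp add: d_def ennreal_mult')
      also have "(\<integral>\<^sup>+ y\<in>half_closed k. ennreal (u y \<tau> * \<psi> n y) \<partial>lborel)
          = (\<integral>\<^sup>+ y. ennreal (u y \<tau> * indicator (half_closed k) y * \<psi> n y) \<partial>lborel)"
        by (intro nn_integral_cong) (simp add: indicator_def)
      also have "ennreal (d n \<tau>) * \<dots> = (\<integral>\<^sup>+ y. ennreal (d n \<tau>) * ennreal (u y \<tau> * indicator (half_closed k) y * \<psi> n y) \<partial>lborel)"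
        by (simp add: nn_integral_cmult)
      also have "\<dots> \<le> I \<tau>"
        unfolding I_def
      proof (rule nn_integral_mono)
        fix y :: "real^'n"
        show "ennreal (d n \<tau>) * ennreal (u y \<tau> * indicator (half_closed k) y * \<psi> n y)
            \<le> ennreal (neumann_kernel k x y (t - \<tau>) * u y \<tau>) * indicator (half_closed k) y"
        proof (cases "y \<in> half_closed k")
          case True
          have "(d n \<tau> * \<psi> n y) * u y \<tau> \<le> neumann_kernel k x y (t - \<tau>) * u y \<tau>"
            using lower[OF \<tau>] u_nonneg[OF True \<tau>(1) \<tau>T] by (intro mult_right_mono)
          hence "d n \<tau> * (u y \<tau> * \<psi> n y) \<le> neumann_kernel k x y (t - \<tau>) * u y \<tau>"
            by (simp add: mult_ac)
          hence "ennreal (d n \<tau> * (u y \<tau> * \<psi> n y)) \<le> ennreal (neumann_kernel k x y (t - \<tau>) * u y \<tau>)"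
            by (rule ennreal_leI)
          with True show ?thesis by (simp add: d_def ennreal_mult')
        qed simp
      qed
      finally show ?thesis .
    qed
    have ev: "\<forall>\<^sub>F \<tau> in at_right 0. 0 < \<tau> \<and> \<tau> \<le> t / 2"
      using eventually_at_right_real[of 0 "t / 2"] t by (auto elim: eventually_mono)
    have eqI: "ennreal (u x t) = I \<tau> + ?D \<tau>" if "0 < \<tau>" "\<tau> \<le> t / 2" for \<tau>
      unfolding I_def using that t x by (intro eq) auto
    have \<alpha>_lim: "(\<alpha> n \<longlongrightarrow> A n) (at_right 0)" for n
      unfolding \<alpha>_def A_def by (rule trace[OF \<psi>_C0])
    have D_lim: "(?D \<longlongrightarrow> ?D 0) (at_right 0)"
      by (rule duhamel_bdry_tendsto[OF adm t])
    have c_lim: "(c \<longlongrightarrow> 1) (at_right 0)"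
      unfolding c_def using t by (auto intro!: tendsto_eq_intros)
    have d_lim: "(d n \<longlongrightarrow> 1) (at_right 0)" for n
      unfolding d_def using t by (auto intro!: tendsto_eq_intros)
    have le1: "ennreal (u x t) \<le> ennreal (A n) + ennreal (e n * u x t') + ?D 0" for n
    proof (rule tendsto_le[OF trivial_limit_at_right_real])
      show "((\<lambda>\<tau>. ennreal (c \<tau> * \<alpha> n \<tau>) + ennreal (e n * u x t') + ?D \<tau>)
          \<longlongrightarrow> ennreal (A n) + ennreal (e n * u x t') + ?D 0) (at_right 0)"
        using tendsto_mult[OF c_lim \<alpha>_lim[of n]] by (intro tendsto_add D_lim tendsto_const tendsto_ennrealI) simp
      show "\<forall>\<^sub>F \<tau> in at_right 0. ennreal (u x t) \<le> ennreal (c \<tau> * \<alpha> n \<tau>) + ennreal (e n * u x t') + ?D \<tau>"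
        using ev
      proof eventually_elim
        case (elim \<tau>)
        thus ?case using eqI[of \<tau>] I_upper[of \<tau> n] by (simp add: add_right_mono)
      qed
    qed (rule tendsto_const)
    have le2: "ennreal (A n) + ?D 0 \<le> ennreal (u x t)" for n
    proof (rule tendsto_le[OF trivial_limit_at_right_real])
      show "((\<lambda>\<tau>. ennreal (d n \<tau> * \<alpha> n \<tau>) + ?D \<tau>) \<longlongrightarrow> ennreal (A n) + ?D 0) (at_right 0)"
        using tendsto_mult[OF d_lim[of n] \<alpha>_lim[of n]] by (intro tendsto_add D_lim tendsto_const tendsto_ennrealI) simp
      show "\<forall>\<^sub>F \<tau> in at_right 0. ennreal (d n \<tau> * \<alpha> n \<tau>) + ?D \<tau> \<le> ennreal (u x t)"
        using ev
      proof eventually_elim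
        case (elim \<tau>)
        thus ?case using eqI[of \<tau>] I_lower[of \<tau> n] by (simp add: add_right_mono)
      qed
    qed (rule tendsto_const)
    let ?B = "\<integral>\<^sup>+ y\<in>half_closed k. ennreal (neumann_kernel k x y t) \<partial>\<mu>"
    \<comment> \<open>Monotone convergence in \<open>\<mu>\<close>; the limit is identified in
      \<open>ennreal\<close>, with no prior finiteness.\<close>
    have A_lim: "(\<lambda>n. ennreal (A n)) \<longlonglongrightarrow> ?B"
      unfolding A_eq[symmetric]
    proof (rule nn_integral_LIMSEQ)
      show "incseq (\<lambda>n y. ennreal (\<psi> n y) * indicator (half_closed k) y)"
        by (auto simp: incseq_def le_fun_def \<psi>_def cut_def intro!: mult_right_mono ennreal_leI mult_left_mono)
      show "(\<lambda>n. ennreal (\<psi> n y) * indicator (half_closed k) y) \<longlonglongrightarrow> ennreal (neumann_kernel k x y t) * indicator (half_closed k) y" for y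
      proof (rule tendsto_eventually)
        have "\<forall>\<^sub>F n in sequentially. norm (x - y) \<le> real n"
          using filterlim_real_sequentially by (simp add: filterlim_at_top)
        thus "\<forall>\<^sub>F n in sequentially. ennreal (\<psi> n y) * indicator (half_closed k) y = ennreal (neumann_kernel k x y t) * indicator (half_closed k) y"
          by eventually_elim (simp add: \<psi>_def cut_def)
      qed
    qed measurable
    have e_lim: "e \<longlonglongrightarrow> 0"
    proof -
      have "filterlim (\<lambda>n. (t' - t) / (t * t') / 4 * (real n)\<^sup>2) at_top sequentially"
        using t t' by (intro filterlim_tendsto_pos_mult_at_top[OF tendsto_const _ filterlim_pow_at_top[OF _ filterlim_real_sequentially]]) auto
      hence "(\<lambda>n. exp (- ((t' - t) / (t * t') / 4 * (real n)\<^sup>2))) \<longlonglongrightarrow> 0"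
        by (rule filterlim_compose[OF exp_at_bot filterlim_compose[OF filterlim_uminus_at_bot_at_top]])
      from tendsto_mult_right_zero[OF this, of "(2 * t' / t) powr (real CARD('n) / 2)"]
      show ?thesis by (simp add: e_def[abs_def] mult.commute)
    qed
    have "ennreal (u x t) \<le> ?B + ?D 0"
    proof (rule LIMSEQ_le_const)
      have "(\<lambda>n. ennreal (e n * u x t')) \<longlonglongrightarrow> ennreal 0"
        using tendsto_mult_left_zero[OF e_lim, of "u x t'"] by (intro tendsto_ennrealI)
      from tendsto_add[OF tendsto_add[OF A_lim this] tendsto_const[of "?D 0"]]
      show "(\<lambda>n. ennreal (A n) + ennreal (e n * u x t') + ?D 0) \<longlonglongrightarrow> ?B + ?D 0" by simp
    qed (use le1 in blast)
    moreover have "?B + ?D 0 \<le> ennreal (u x t)"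
    proof (rule LIMSEQ_le_const2)
      show "(\<lambda>n. ennreal (A n) + ?D 0) \<longlonglongrightarrow> ?B + ?D 0"
        by (intro tendsto_add A_lim tendsto_const)
    qed (use le2 in blast)
    ultimately show ?thesis by (rule antisym)
  qed
  with adm show ?thesis by (simp add: initial_boundary_problem_solution_def)
qed

theorem theorem1p2:
  fixes k :: "'n::finite" and p T :: real and \<mu> :: "(real^'n) measure"
    and u :: "real^'n \<Rightarrow> real \<Rightarrow> real"
  assumes "p > 1" and "T > 0"
    and "radon_measure \<mu>" and "measure_support \<mu> \<subseteq> half_closed k"
  shows "(initial_boundary_problem_solution k p T \<mu> u \<longrightarrow>
            (\<forall>\<phi>\<in>C0. ((\<lambda>t. LINT y:half_closed k|lborel. u y t * \<phi> y)
                        \<longlongrightarrow> (LINT y:half_closed k|\<mu>. \<phi> y)) (at_right 0)))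
       \<and> (boundary_problem_solution k p T u \<and>
            (\<forall>\<phi>\<in>C0. ((\<lambda>t. LINT y:half_closed k|lborel. u y t * \<phi> y)
                        \<longlongrightarrow> (LINT y:half_closed k|\<mu>. \<phi> y)) (at_right 0))
          \<longrightarrow> initial_boundary_problem_solution k p T \<mu> u)"
proof (intro conjI impI ballI)
  fix \<phi> :: "real^'n \<Rightarrow> real"
  assume "initial_boundary_problem_solution k p T \<mu> u" "\<phi> \<in> C0"
  thus "((\<lambda>t. LINT y:half_closed k|lborel. u y t * \<phi> y) \<longlongrightarrow> (LINT y:half_closed k|\<mu>. \<phi> y)) (at_right 0)"
    by (rule initial_trace[OF assms(2,3)])
next
  assume "boundary_problem_solution k p T u \<and>
            (\<forall>\<phi>\<in>C0. ((\<lambda>t. LINT y:half_closed k|lborel. u y t * \<phi> y)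
                        \<longlongrightarrow> (LINT y:half_closed k|\<mu>. \<phi> y)) (at_right 0))"
  thus "initial_boundary_problem_solution k p T \<mu> u"
    using boundary_problem_imp_initial_boundary_problem[OF assms(3)] by blast
qed

end
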